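(* For each $n\ge 1$ let $D_n$ be the formal derivative associated with the grammar $$G_n=\{x_k\to(s+t)x_{n+1}y_{n+1},\; y_k\to(s+t)x_{n+1}y_{n+1}\ (1\le k\le n),\; s\to s(sx_{n+1}+ty_{n+1}),\; t\to t(sx_{n+1}+ty_{n+1})\}.$$ Then for every $n\ge1$, $$F_n(\mathbf{x},\mathbf{y},s,t)=D_nD_{n-1}\cdots D_1(y_1)$$ and $$F^*_n(\mathbf{x},\mathbf{y},s,t)=D_{n+1}D_n\cdots D_2(t),$$ where $F_n$ and $F_n^*$ are the weighted generating polynomials of labeled plane trees defined in the context.
   Context: The formal derivative associated with a grammar (a set of substitution rules $v\to p_v$, $v$ a variable) is the linear operator $D$ on Laurent polynomials in the variables with $D(v)=p_v$ for each rule, $D(u+w)=D(u)+D(w)$, $D(uw)=D(u)w+uD(w)$. Here $D_n$ acts on (Laurent) polynomials in $x_1,\dots,x_n,y_1,\dots,y_n,s,t$ and produces ones in $x_1,\dots,x_{n+1},y_1,\dots,y_{n+1},s,t$. A labeled plane tree with $m$ nodes is a rooted plane tree (the children of each node are linearly ordered from left to right) whose nodes are labeled bijectively by $[m]=\{1,\dots,m\}$. Node with label $i$ is written $\mathbf{i}$. A node is a leaf if it has no children, and an interior node otherwise. The leftmost child of an interior node is called its old child. Siblings to the left of a node are its elder siblings. For a node $\mathbf{j}$, $\beta(\mathbf{j})$ is the smallest label of a node in the subtree rooted at $\mathbf{j}$ (including $\mathbf{j}$). For a non-root node $\mathbf{j}$ with parent $\mathbf{i}$ and elder siblings $\mathbf{k}_1,\dots,\mathbf{k}_{r}$,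 $\alpha(\mathbf{j})=\min(i,\beta(\mathbf{k}_1),\dots,\beta(\mathbf{k}_r))$. An edge $(\mathbf{i},\mathbf{j})$ with parent $\mathbf{i}$ and child $\mathbf{j}$ is proper if $\alpha(\mathbf{j})<\beta(\mathbf{j})$, and improper otherwise. Let $imp(T)$ be the number of improper edges of $T$. For a labeled plane tree $T$ with $m\ge 2$ nodes define $f(\mathbf{i})=\max\{i,\alpha(\mathbf{i})\}$ if $\mathbf{i}$ is a leaf, and $f(\mathbf{i})=\max\{i,\beta(\mathbf{j})\}$ if $\mathbf{i}$ is an interior node with old child $\mathbf{j}$. Each proper edge gets variable $s$, each improper edge gets variable $t$, each leaf $\mathbf{i}$ gets variable $x_{f(\mathbf{i})}$, and each interior node $\mathbf{i}$ gets variable $y_{f(\mathbf{i})}$. Let $\mathcal{T}_{n+1}$ be the set of labeled plane trees with $n+1$ nodes. Then $$F_n(\mathbf{x},\mathbf{y},s,t)=\sum_{T\in\mathcal{T}_{n+1}} s^{\,n-imp(T)}t^{\,imp(T)}\prod_{\mathbf{i}\text{ leaf of }T}x_{f(\mathbf{i})}\prod_{\mathbf{j}\text{ interior node of }T}y_{f(\mathbf{j})}.$$ Let $\mathcal{T}^*_n$ be the set of labeled plane trees with $n+2$ nodes in which node $\mathbf{1}$ is a leaf and is the leftmost child of node $\mathbf{2}$. Then $$F^*_n(\mathbf{x},\mathbf{y},s,t)=\sum_{T\in\mathcal{T}^*_{n}} s^{\,n+1-imp(T)}t^{\,imp(T)}\prod_{\substack{\mathbf{i}\text{ leaf of }T\\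 \mathbf{i}\ne\mathbf{1}}}x_{f(\mathbf{i})}\prod_{\substack{\mathbf{j}\text{ interior node of }T\\ \mathbf{j}\neq\mathbf{2}}}y_{f(\mathbf{j})},$$ i.e. nodes $\mathbf{1}$ and $\mathbf{2}$ contribute no variable. *)

theory Defs
  imports "HOL-Library.Poly_Mapping"
begin

datatype letter = LX nat | LY nat | LS | LT

text \<open>A monomial is a finitely supported integer exponent vector, and a Laurent polynomial is a
  finitely supported family of coefficients; multiplication on \<^typ>\<open>'b \<Rightarrow>\<^sub>0 'a\<close> is the convolution
  product.\<close>

type_synonym monomial = "letter \<Rightarrow>\<^sub>0 int"
type_synonym 'a laurent = "monomial \<Rightarrow>\<^sub>0 'a"

definition const :: "'a::comm_ring_1 \<Rightarrow> 'a laurent" where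
  "const c = Poly_Mapping.single 0 c"

definition var :: "letter \<Rightarrow> 'a::comm_ring_1 laurent" where
  "var v = Poly_Mapping.single (Poly_Mapping.single v 1) 1"

abbreviation xvar :: "nat \<Rightarrow> 'a::comm_ring_1 laurent" where "xvar k \<equiv> var (LX k)"
abbreviation yvar :: "nat \<Rightarrow> 'a::comm_ring_1 laurent" where "yvar k \<equiv> var (LY k)"
abbreviation svar :: "'a::comm_ring_1 laurent" where "svar \<equiv> var LS"
abbreviation tvar :: "'a::comm_ring_1 laurent" where "tvar \<equiv> var LT"

definition laurent_on :: "letter set \<Rightarrow> 'a::comm_ring_1 laurent set" where
  "laurent_on V = {p. \<forall>m \<in> Poly_Mapping.keys p. Poly_Mapping.keys m \<subseteq> V}"

type_synonym 'a grammar = "letter \<rightharpoonup> 'a laurent"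

text \<open>The formal derivative of a grammar is only specified on the Laurent polynomials in the
  letters that have a rule; nothing is assumed about its values elsewhere.\<close>

definition formal_derivative ::
  "'a::comm_ring_1 grammar \<Rightarrow> ('a laurent \<Rightarrow> 'a laurent) \<Rightarrow> bool" where
  "formal_derivative G D \<longleftrightarrow>
     (\<forall>v p. G v = Some p \<longrightarrow> D (var v) = p) \<and>
     (\<forall>c. \<forall>u \<in> laurent_on (dom G). D (const c * u) = const c * D u) \<and>
     (\<forall>u \<in> laurent_on (dom G). \<forall>w \<in> laurent_on (dom G). D (u + w) = D u + D w) \<and>
     (\<forall>u \<in> laurent_on (dom G). \<forall>w \<in> laurent_on (dom G). D (u * w) = D u * w + u * D w)"

fun grammar :: "nat \<Rightarrow> 'a::comm_ring_1 grammar" where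
  "grammar n (LX k) =
     (if 1 \<le> k \<and> k \<le> n then Some ((svar + tvar) * xvar (n + 1) * yvar (n + 1)) else None)"
| "grammar n (LY k) =
     (if 1 \<le> k \<and> k \<le> n then Some ((svar + tvar) * xvar (n + 1) * yvar (n + 1)) else None)"
| "grammar n LS = Some (svar * (svar * xvar (n + 1) + tvar * yvar (n + 1)))"
| "grammar n LT = Some (tvar * (svar * xvar (n + 1) + tvar * yvar (n + 1)))"

definition dmono :: "'a::comm_ring_1 grammar \<Rightarrow> monomial \<Rightarrow> 'a laurent" where
  "dmono G m = (\<Sum>v \<in> Poly_Mapping.keys m.
     Poly_Mapping.single (m - Poly_Mapping.single v 1) (of_int (Poly_Mapping.lookup m v))
       * (case G v of None \<Rightarrow> 0 | Some p \<Rightarrow> p))"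

definition dpoly :: "'a::comm_ring_1 grammar \<Rightarrow> 'a laurent \<Rightarrow> 'a laurent" where
  "dpoly G p = (\<Sum>m \<in> Poly_Mapping.keys p. const (Poly_Mapping.lookup p m) * dmono G m)"

lemma dmono_superset:
  assumes "finite K" "Poly_Mapping.keys m \<subseteq> K"
  shows "dmono G m = (\<Sum>v \<in> K.
     Poly_Mapping.single (m - Poly_Mapping.single v 1) (of_int (Poly_Mapping.lookup m v))
       * (case G v of None \<Rightarrow> 0 | Some p \<Rightarrow> p))"
  unfolding dmono_def
  by (rule sum.mono_neutral_left) (use assms in \<open>auto simp: in_keys_iff\<close>)

lemma dpoly_superset:
  assumes "finite K" "Poly_Mapping.keys p \<subseteq> K"
  shows "dpoly G p = (\<Sum>m \<in> K. const (Poly_Mapping.lookup p m) * dmono G m)"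
  unfolding dpoly_def
  by (rule sum.mono_neutral_left) (use assms in \<open>auto simp: in_keys_iff const_def\<close>)

lemma dmono_add:
  "dmono G (m + m') =
     Poly_Mapping.single m' 1 * dmono G m + Poly_Mapping.single m 1 * dmono G m'"
proof -
  let ?K = "Poly_Mapping.keys m \<union> Poly_Mapping.keys m'"
  have K: "finite ?K" by simp
  have "Poly_Mapping.keys (m + m') \<subseteq> ?K" by (rule keys_add)
  note e = dmono_superset[OF K this, of G]
  have e1: "dmono G m = (\<Sum>v \<in> ?K.
     Poly_Mapping.single (m - Poly_Mapping.single v 1) (of_int (Poly_Mapping.lookup m v))
       * (case G v of None \<Rightarrow> 0 | Some p \<Rightarrow> p))"
    by (rule dmono_superset) auto
  have e2: "dmono G m' = (\<Sum>v \<in> ?K.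
     Poly_Mapping.single (m' - Poly_Mapping.single v 1) (of_int (Poly_Mapping.lookup m' v))
       * (case G v of None \<Rightarrow> 0 | Some p \<Rightarrow> p))"
    by (rule dmono_superset) auto
  show ?thesis
    unfolding e e1 e2 sum_distrib_left sum.distrib[symmetric]
  proof (rule sum.cong[OF refl], goal_cases)
    case (1 v)
    let ?s = "Poly_Mapping.single v (1::int)"
    have a: "m' + (m - ?s) = m + m' - ?s" "m + (m' - ?s) = m + m' - ?s"
      by (simp_all add: algebra_simps)
    show ?case
      by (simp add: mult.assoc[symmetric] mult_single a lookup_add single_add distrib_right
          del: mult.assoc)
  qed
qed

lemma dpoly_add: "dpoly G (p + q) = dpoly G p + dpoly G q"
proof -
  let ?K = "Poly_Mapping.keys p \<union> Poly_Mapping.keys q"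
  have "dpoly G (p + q) = (\<Sum>m \<in> ?K. const (Poly_Mapping.lookup (p + q) m) * dmono G m)"
    by (rule dpoly_superset) (use keys_add[of p q] in auto)
  moreover have "dpoly G p = (\<Sum>m \<in> ?K. const (Poly_Mapping.lookup p m) * dmono G m)"
    by (rule dpoly_superset) auto
  moreover have "dpoly G q = (\<Sum>m \<in> ?K. const (Poly_Mapping.lookup q m) * dmono G m)"
    by (rule dpoly_superset) auto
  ultimately show ?thesis
    by (simp add: sum.distrib lookup_add const_def single_add distrib_right)
qed

lemma dpoly_single: "dpoly G (Poly_Mapping.single m c) = const c * dmono G m"
  by (subst dpoly_superset[of "{m}"]) (auto split: if_splits)

lemma laurent_induct [case_names single add]:
  assumes "\<And>m c. P (Poly_Mapping.single m c)"
    and "\<And>p q. P p \<Longrightarrow> P q \<Longrightarrow> P (p + q)"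
  shows "P (p :: 'a::comm_ring_1 laurent)"
proof (induction p rule: update_induct)
  case const
  show ?case using assms(1)[of 0 0] by simp
next
  case (update f a b)
  have "Poly_Mapping.update a b f = f + Poly_Mapping.single a b"
    by (rule poly_mapping_eqI)
       (use update in \<open>auto simp: lookup_update lookup_add lookup_single when_def in_keys_iff\<close>)
  then show ?case using assms update by simp
qed

lemma dpoly_mult: "dpoly G (p * q) = dpoly G p * q + p * dpoly G q"
proof (induction p rule: laurent_induct)
  case (single m c)
  show ?case
  proof (induction q rule: laurent_induct)
    case (single m' c')
    have a: "Poly_Mapping.single m c = const c * Poly_Mapping.single m 1"
            "Poly_Mapping.single m' c' = const c' * Poly_Mapping.single m' 1"
            "const (c * c') = const c * const c'"
      by (simp_all add: const_def mult_single)
    have "dpoly G (Poly_Mapping.single m c * Poly_Mapping.single m' c')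
      = const (c * c') * dmono G (m + m')"
      by (simp add: mult_single dpoly_single)
    also have "\<dots> = const c * dmono G m * (const c' * Poly_Mapping.single m' 1)
        + const c * Poly_Mapping.single m 1 * (const c' * dmono G m')"
      by (simp only: a(3) dmono_add) (simp add: algebra_simps)
    finally show ?case
      by (simp only: dpoly_single a(1,2)[symmetric])
  next
    case (add q q')
    then show ?case by (simp add: distrib_left dpoly_add algebra_simps)
  qed
next
  case (add p p')
  then show ?case by (simp add: distrib_right dpoly_add algebra_simps)
qed

lemma formal_derivative_exists: "formal_derivative G (dpoly G)"
proof -
  have "dpoly G (var v) = p" if "G v = Some p" for v p
    using that by (simp add: var_def dpoly_single dmono_def const_def)
  moreover have "dpoly G (const c * u) = const c * dpoly G u" for c u
    by (simp add: dpoly_mult) (simp add: const_def dpoly_single dmono_def)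
  ultimately show ?thesis
    by (simp add: formal_derivative_def dpoly_add dpoly_mult)
qed

datatype ltree = Node (root_label: nat) (branches: "ltree list")

fun labels :: "ltree \<Rightarrow> nat list" where
  "labels (Node i ts) = i # concat (map labels ts)"

definition nodes :: "ltree \<Rightarrow> nat set" where
  "nodes T = set (labels T)"

definition labeled_trees :: "nat \<Rightarrow> ltree set" where
  "labeled_trees m = {T. distinct (labels T) \<and> nodes T = {1..m}}"

fun subtrees :: "ltree \<Rightarrow> ltree set" where
  "subtrees (Node i ts) = insert (Node i ts) (\<Union>t \<in> set ts. subtrees t)"

text \<open>Since the labels of a labeled plane tree are pairwise distinct, a node is identified with its
  label. The descriptions below are well defined by \<open>subtree_at_unique\<close> and \<open>parent_unique\<close>.\<close>

definition subtree_at :: "ltree \<Rightarrow> nat \<Rightarrow> ltree" where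
  "subtree_at T i = (THE t. t \<in> subtrees T \<and> root_label t = i)"

definition children :: "ltree \<Rightarrow> nat \<Rightarrow> nat list" where
  "children T i = map root_label (branches (subtree_at T i))"

definition edges :: "ltree \<Rightarrow> (nat \<times> nat) set" where
  "edges T = {(i, j). i \<in> nodes T \<and> j \<in> set (children T i)}"

definition parent :: "ltree \<Rightarrow> nat \<Rightarrow> nat" where
  "parent T j = (THE i. (i, j) \<in> edges T)"

definition elder_siblings :: "ltree \<Rightarrow> nat \<Rightarrow> nat set" where
  "elder_siblings T j = set (takeWhile (\<lambda>k. k \<noteq> j) (children T (parent T j)))"

definition leaves :: "ltree \<Rightarrow> nat set" where
  "leaves T = {i \<in> nodes T. children T i = []}"

definition interior_nodes :: "ltree \<Rightarrow> nat set" where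
  "interior_nodes T = {i \<in> nodes T. children T i \<noteq> []}"

definition old_child :: "ltree \<Rightarrow> nat \<Rightarrow> nat" where
  "old_child T i = hd (children T i)"

definition beta :: "ltree \<Rightarrow> nat \<Rightarrow> nat" where
  "beta T j = Min (nodes (subtree_at T j))"

text \<open>Only meaningful for a non-root node \<open>j\<close>.\<close>

definition alpha :: "ltree \<Rightarrow> nat \<Rightarrow> nat" where
  "alpha T j = Min (insert (parent T j) (beta T ` elder_siblings T j))"

definition improper_edges :: "ltree \<Rightarrow> (nat \<times> nat) set" where
  "improper_edges T = {(i, j) \<in> edges T. \<not> alpha T j < beta T j}"

definition imp :: "ltree \<Rightarrow> nat" where
  "imp T = card (improper_edges T)"

text \<open>In a tree with at least two nodes the root is not a leaf, so \<^const>\<open>alpha\<close> is only used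
  at non-root nodes.\<close>

definition node_index :: "ltree \<Rightarrow> nat \<Rightarrow> nat" where
  "node_index T i =
     (if i \<in> leaves T then max i (alpha T i) else max i (beta T (old_child T i)))"

lemma root_label_in_labels: "root_label t \<in> set (labels t)"
  by (cases t) simp

lemma subtrees_labels: "t \<in> subtrees T \<Longrightarrow> set (labels t) \<subseteq> set (labels T)"
  by (induction T rule: subtrees.induct) fastforce

lemma distinct_branch:
  "distinct (concat (map labels ts)) \<Longrightarrow> t \<in> set ts \<Longrightarrow> distinct (labels t)"
  by (induction ts) auto

lemma distinct_branches_disjoint:
  "distinct (concat (map labels ts)) \<Longrightarrow> t \<in> set ts \<Longrightarrow> u \<in> set ts \<Longrightarrow>
    j \<in> set (labels t) \<Longrightarrow> j \<in> set (labels u) \<Longrightarrow> t = u"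
  by (induction ts) auto

lemma subtree_ex: "i \<in> set (labels T) \<Longrightarrow> \<exists>t \<in> subtrees T. root_label t = i"
  by (induction T rule: subtrees.induct) auto

lemma subtree_inj:
  "distinct (labels T) \<Longrightarrow> t \<in> subtrees T \<Longrightarrow> u \<in> subtrees T \<Longrightarrow>
    root_label t = root_label u \<Longrightarrow> t = u"
proof (induction T rule: subtrees.induct)
  case (1 i ts)
  have not_root: "root_label r \<noteq> i" if "w \<in> set ts" "r \<in> subtrees w" for w r
    using that subtrees_labels[of r w] root_label_in_labels[of r] "1.prems"(1) by auto
  consider "t = Node i ts" "u = Node i ts"
    | w where "w \<in> set ts" "t \<in> subtrees w" "u = Node i ts"
    | w where "w \<in> set ts" "u \<in> subtrees w" "t = Node i ts"
    | w w' where "w \<in> set ts" "t \<in> subtrees w" "w' \<in> set ts" "u \<in> subtrees w'"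
    using "1.prems"(2,3) by auto
  then show ?case
  proof cases
    case (4 w w')
    have "root_label t \<in> set (labels w)"
      using subtrees_labels[OF 4(2)] root_label_in_labels by blast
    moreover have "root_label t \<in> set (labels w')"
      using subtrees_labels[OF 4(4)] root_label_in_labels[of u] "1.prems"(4) by auto
    ultimately have "w = w'"
      using distinct_branches_disjoint[of ts w w'] 4 "1.prems"(1) by auto
    then show ?thesis
      using "1.IH"[OF 4(1)] 4 "1.prems" distinct_branch[of ts w] by auto
  qed (use not_root "1.prems"(4) in fastforce)+
qed

lemma subtree_at_unique:
  assumes "distinct (labels T)" "i \<in> nodes T"
  shows "\<exists>!t. t \<in> subtrees T \<and> root_label t = i"
  using subtree_ex[of i T] subtree_inj[OF assms(1)] assms(2) unfolding nodes_def by blast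

lemma subtree_at_eq:
  "distinct (labels T) \<Longrightarrow> t \<in> subtrees T \<Longrightarrow> subtree_at T (root_label t) = t"
  unfolding subtree_at_def by (rule the_equality) (auto intro: subtree_inj)

lemma branch_root_in_labels:
  "u \<in> set (branches t) \<Longrightarrow> root_label u \<in> set (concat (map labels (branches t)))"
  using root_label_in_labels by auto

lemma subtree_parent_inj:
  "distinct (labels T) \<Longrightarrow> t \<in> subtrees T \<Longrightarrow> t' \<in> subtrees T \<Longrightarrow>
    j \<in> root_label ` set (branches t) \<Longrightarrow> j \<in> root_label ` set (branches t') \<Longrightarrow> t = t'"
proof (induction T rule: subtrees.induct)
  case (1 i ts)
  have inner: "j \<in> set (labels w) \<and> j \<noteq> root_label w"
    if *: "w \<in> set ts" "r \<in> subtrees w" "j \<in> root_label ` set (branches r)" for w r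
  proof -
    obtain a us where r: "r = Node a us" by (cases r)
    obtain b vs where w: "w = Node b vs" by (cases w)
    have d: "distinct (labels w)" using distinct_branch[of ts w] *(1) "1.prems"(1) by simp
    have j: "j \<in> set (concat (map labels us))"
      using *(3) branch_root_in_labels[of _ r] r by auto
    then have jw: "j \<in> set (labels w)" using subtrees_labels[OF *(2)] r by auto
    have "j \<noteq> b"
    proof (cases "r = w")
      case True
      then show ?thesis using j r w d by auto
    next
      case False
      then obtain v where "v \<in> set vs" "r \<in> subtrees v" using *(2) w by auto
      then have "j \<in> set (concat (map labels vs))"
        using subtrees_labels[of r v] j r by auto
      then show ?thesis using d w by auto
    qed
    then show ?thesis using jw w by simp
  qed
  have no: False
    if *: "w \<in> set ts" "r \<in> subtrees w" "j \<in> root_label ` set (branches r)"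
       "j \<in> root_label ` set ts" for w r
  proof -
    obtain v where v: "v \<in> set ts" "j = root_label v" using *(4) by auto
    have "v = w"
      using distinct_branches_disjoint[of ts v w j] v *(1) inner[OF *(1-3)]
        root_label_in_labels[of v] "1.prems"(1) by auto
    then show False using inner[OF *(1-3)] v by simp
  qed
  consider "t = Node i ts" "t' = Node i ts"
    | w where "w \<in> set ts" "t \<in> subtrees w" "t' = Node i ts"
    | w where "w \<in> set ts" "t' \<in> subtrees w" "t = Node i ts"
    | w w' where "w \<in> set ts" "t \<in> subtrees w" "w' \<in> set ts" "t' \<in> subtrees w'"
    using "1.prems"(2,3) by auto
  then show ?case
  proof cases
    case 1
    then show ?thesis by simp
  next
    case (2 w)
    then show ?thesis using no[of w t] "1.prems"(4,5) by simp
  next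
    case (3 w)
    then show ?thesis using no[of w t'] "1.prems"(4,5) by simp
  next
    case (4 w w')
    have "w = w'"
      using distinct_branches_disjoint[of ts w w' j] 4(1,3) "1.prems"(1)
        inner[OF 4(1,2) "1.prems"(4)] inner[OF 4(3,4) "1.prems"(5)] by simp
    moreover have "distinct (labels w)"
      using distinct_branch[of ts w] 4(1) "1.prems"(1) by simp
    ultimately show ?thesis
      using "1.IH"[OF 4(1) _ 4(2) _ "1.prems"(4,5)] 4(4) by simp
  qed
qed

lemma parent_unique:
  assumes "distinct (labels T)" "(i, j) \<in> edges T" "(i', j) \<in> edges T"
  shows "i = i'"
proof -
  obtain t where t: "t \<in> subtrees T" "root_label t = i"
    using subtree_ex[of i T] assms(2) by (auto simp: edges_def nodes_def)
  obtain t' where t': "t' \<in> subtrees T" "root_label t' = i'"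
    using subtree_ex[of i' T] assms(3) by (auto simp: edges_def nodes_def)
  have "t = t'"
    using subtree_parent_inj[OF assms(1) t(1) t'(1), of j] assms(2,3)
      subtree_at_eq[OF assms(1) t(1)] subtree_at_eq[OF assms(1) t'(1)] t(2) t'(2)
    by (auto simp: edges_def children_def)
  then show ?thesis using t(2) t'(2) by simp
qed

lemma finite_trees_bounded:
  assumes "finite A"
  shows "finite {T. length (labels T) \<le> m \<and> nodes T \<subseteq> A}"
proof (induction m)
  case 0
  have "length (labels T) \<noteq> 0" for T by (cases T) simp
  then have "{T. length (labels T) \<le> 0 \<and> nodes T \<subseteq> A} = {}" by auto
  then show ?case by (metis finite.emptyI)
next
  case (Suc m)
  let ?S = "{T. length (labels T) \<le> m \<and> nodes T \<subseteq> A}"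
  let ?L = "{ts. set ts \<subseteq> ?S \<and> length ts \<le> m}"
  have len: "length ts \<le> length (concat (map labels ts))" for ts
  proof (induction ts)
    case (Cons t ts)
    then show ?case by (cases t) auto
  qed simp
  have part: "length (labels t) \<le> length (concat (map labels ts))" if "t \<in> set ts" for t ts
    using that by (induction ts) auto
  have "{T. length (labels T) \<le> Suc m \<and> nodes T \<subseteq> A} \<subseteq> (\<lambda>(a, ts). Node a ts) ` (A \<times> ?L)"
  proof
    fix T assume T: "T \<in> {T. length (labels T) \<le> Suc m \<and> nodes T \<subseteq> A}"
    obtain a ts where N: "T = Node a ts" by (cases T)
    have "length (concat (map labels ts)) \<le> m" using T N by simp
    then have "length ts \<le> m" "\<forall>t \<in> set ts. length (labels t) \<le> m"
      using len[of ts] part[of _ ts] by (auto intro: order_trans)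
    then have "ts \<in> ?L" using T N by (auto simp: nodes_def)
    moreover have "a \<in> A" using T N by (simp add: nodes_def)
    ultimately show "T \<in> (\<lambda>(a, ts). Node a ts) ` (A \<times> ?L)" using N by force
  qed
  moreover have "finite (A \<times> ?L)"
    using finite_lists_length_le[OF Suc.IH, of m] assms by simp
  ultimately show ?case by (rule finite_subset[OF _ finite_imageI])
qed

lemma finite_labeled_trees: "finite (labeled_trees m)"
proof (rule finite_subset[OF _ finite_trees_bounded[of "{1..m}" m]])
  show "labeled_trees m \<subseteq> {T. length (labels T) \<le> m \<and> nodes T \<subseteq> {1..m}}"
    by (auto simp: labeled_trees_def nodes_def distinct_card[symmetric])
qed simp

definition F :: "nat \<Rightarrow> 'a::comm_ring_1 laurent" where
  "F n = (\<Sum>T \<in> labeled_trees (n + 1).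
     svar ^ (n - imp T) * tvar ^ imp T
       * (\<Prod>i \<in> leaves T. xvar (node_index T i))
       * (\<Prod>j \<in> interior_nodes T. yvar (node_index T j)))"

definition star_trees :: "nat \<Rightarrow> ltree set" where
  "star_trees n = {T \<in> labeled_trees (n + 2).
     1 \<in> leaves T \<and> 2 \<in> interior_nodes T \<and> old_child T 2 = 1}"

definition F_star :: "nat \<Rightarrow> 'a::comm_ring_1 laurent" where
  "F_star n = (\<Sum>T \<in> star_trees n.
     svar ^ (n + 1 - imp T) * tvar ^ imp T
       * (\<Prod>i \<in> leaves T - {1}. xvar (node_index T i))
       * (\<Prod>j \<in> interior_nodes T - {2}. yvar (node_index T j)))"

end

theory Submission
  imports Defs "HOL-Library.Multiset"
begin

text \<open>The node with the largest label \<open>m\<close> is removed from a tree. If it is a leaf, it is deleted. If it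
  is interior, it is merged with its old child \<open>v\<close>, whose children are put in front of the other
  children of \<open>m\<close>. Conversely, a tree without \<open>m\<close>, a node \<open>v\<close> with \<open>d\<close> children and a number
  \<open>0 \<le> k \<le> d\<close> determine one tree of either kind. The new edge is proper in the first kind
  and the edge from \<open>m\<close> to \<open>v\<close> is improper in the second; all other edges keep their status.

  For \<open>k = 0\<close> the variable of \<open>v\<close> is replaced, so that both kinds together give
  \<open>x\<^sub>i, y\<^sub>i \<rightarrow> (s + t) x\<^sub>m y\<^sub>m\<close>. For \<open>k > 0\<close> all old variables are kept and a factor \<open>s x\<^sub>m\<close> or
  \<open>t y\<^sub>m\<close> appears, which is the action of the derivative on the variable of the edge to the
  \<open>k\<close>-th child of \<open>v\<close>. In the second generating function the nodes 1 and 2 have no variable, and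
  accordingly \<open>k = 0\<close> is the one choice at these nodes that destroys the shape of the tree.\<close>

section \<open>Recursive form of the weight of a tree\<close>

definition min_label :: "ltree \<Rightarrow> nat" where
  "min_label t = Min (nodes t)"

text \<open>Started at the label of the parent, the fold over the elder siblings gives the
  \<alpha>-value of the next child, and the fold over all children the \<beta>-value of the
  parent.\<close>

definition running_min :: "nat \<Rightarrow> ltree list \<Rightarrow> nat" where
  "running_min a ts = foldl (\<lambda>b t. min b (min_label t)) a ts"

definition edge_weight :: "bool \<Rightarrow> 'a::comm_ring_1 laurent" where
  "edge_weight proper = (if proper then svar else tvar)"

definition node_weight :: "nat set \<Rightarrow> nat \<Rightarrow> nat \<Rightarrow> ltree list \<Rightarrow> 'a::comm_ring_1 laurent" where
  "node_weight A a i ts =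
     (if i \<in> A then 1 else if ts = [] then xvar (max i a) else yvar (max i (min_label (hd ts))))"

text \<open>\<open>tree_weight A a t\<close> is the weight of a subtree \<open>t\<close> whose root has \<open>\<alpha>\<close>-value \<open>a\<close> in the whole tree,
  where the nodes in \<open>A\<close> carry no variable. In \<open>forest_weight A a ts\<close> the list \<open>ts\<close> is a final part of
  the children of a node, and \<open>a\<close> is the \<open>\<alpha>\<close>-value of the first of them.\<close>

fun tree_weight :: "nat set \<Rightarrow> nat \<Rightarrow> ltree \<Rightarrow> 'a::comm_ring_1 laurent"
  and forest_weight :: "nat set \<Rightarrow> nat \<Rightarrow> ltree list \<Rightarrow> 'a::comm_ring_1 laurent" where
  "tree_weight A a (Node i ts) = node_weight A a i ts * forest_weight A i ts"
| "forest_weight A a [] = 1"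
| "forest_weight A a (t # ts) =
     edge_weight (a < min_label t) * tree_weight A a t * forest_weight A (min a (min_label t)) ts"

section \<open>Insertion of a new largest label\<close>

definition insert_leaf :: "nat \<Rightarrow> nat \<Rightarrow> ltree list \<Rightarrow> nat \<Rightarrow> ltree" where
  "insert_leaf m v cs k = Node v (take k cs @ Node m [] # drop k cs)"

definition insert_parent :: "nat \<Rightarrow> nat \<Rightarrow> ltree list \<Rightarrow> nat \<Rightarrow> ltree" where
  "insert_parent m v cs k = Node m (Node v (take k cs) # drop k cs)"

definition insert_positions :: "nat set \<Rightarrow> nat \<Rightarrow> ltree list \<Rightarrow> nat set" where
  "insert_positions A v cs = {k. k \<le> length cs \<and> (v \<in> A \<longrightarrow> k \<noteq> 0)}"

fun tree_insertions :: "nat set \<Rightarrow> nat \<Rightarrow> ltree \<Rightarrow> ltree set"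
  and forest_insertions :: "nat set \<Rightarrow> nat \<Rightarrow> ltree list \<Rightarrow> ltree list set" where
  "tree_insertions A m (Node v cs) =
     insert_leaf m v cs ` insert_positions A v cs
     \<union> insert_parent m v cs ` insert_positions A v cs
     \<union> Node v ` forest_insertions A m cs"
| "forest_insertions A m [] = {}"
| "forest_insertions A m (t # ts) =
     (\<lambda>t'. t' # ts) ` tree_insertions A m t \<union> (#) t ` forest_insertions A m ts"

lemma finite_insert_positions [simp]: "finite (insert_positions A v cs)"
  by (rule finite_subset[of _ "{..length cs}"]) (auto simp: insert_positions_def)

lemma finite_insertions [simp]:
  "finite (tree_insertions A m t)" "finite (forest_insertions A m ts)"
  by (induction A m t and A m ts rule: tree_insertions_forest_insertions.induct) auto

lemma finite_nodes [simp]: "finite (nodes t)"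
  by (simp add: nodes_def)

lemma nodes_ne [simp]: "nodes t \<noteq> {}"
  by (cases t) (simp add: nodes_def)

lemma nodes_Node: "nodes (Node i ts) = insert i (\<Union>t\<in>set ts. nodes t)"
  by (auto simp: nodes_def)

lemma running_min_simps [simp]:
  "running_min a [] = a"
  "running_min a (t # ts) = running_min (min a (min_label t)) ts"
  "running_min a (ts @ us) = running_min (running_min a ts) us"
  by (simp_all add: running_min_def)

lemma running_min_le: "running_min a ts \<le> a"
proof (induction ts arbitrary: a)
  case (Cons t ts)
  show ?case using Cons[of "min a (min_label t)"] by simp
qed simp

lemma running_min_eq: "running_min a ts = Min (insert a (\<Union>t\<in>set ts. nodes t))"
proof (induction ts arbitrary: a)
  case (Cons t ts)
  have "running_min a (t # ts) = Min (insert (min a (min_label t)) (\<Union>t\<in>set ts. nodes t))"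
    by (simp add: Cons)
  also have "\<dots> = Min (insert a (\<Union>t\<in>set (t # ts). nodes t))"
    by (cases "(\<Union>t\<in>set ts. nodes t) = {}") (simp_all add: min_label_def Min_Un ac_simps)
  finally show ?case .
qed simp

lemma min_label_Node: "min_label (Node i ts) = running_min i ts"
  by (simp add: min_label_def running_min_eq nodes_Node)

lemma min_label_in: "min_label t \<in> nodes t"
  by (simp add: min_label_def)

lemma forest_weight_append:
  "forest_weight A a (ts @ us) = forest_weight A a ts * forest_weight A (running_min a ts) us"
  by (induction ts arbitrary: a) (simp_all add: mult.assoc)

text \<open>Multisets record the set of labels and their distinctness at once, so this one count
  settles membership in \<open>labeled_trees\<close> in both directions.\<close>

lemma mset_labels_insertions:
  "t' \<in> tree_insertions A m t \<Longrightarrow> mset (labels t') = add_mset m (mset (labels t))"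
  "ts' \<in> forest_insertions A m ts \<Longrightarrow>
     mset (concat (map labels ts')) = add_mset m (mset (concat (map labels ts)))"
proof (induction A m t and A m ts arbitrary: t' and ts' rule: tree_insertions_forest_insertions.induct)
  case (1 A m v cs)
  have split: "mset (concat (map labels (take k cs))) + mset (concat (map labels (drop k cs)))
      = mset (concat (map labels cs))" for k
    by (metis append_take_drop_id concat_append map_append mset_append)
  from 1 show ?case
    using split by (auto simp: insert_leaf_def insert_parent_def)
qed auto

lemma nodes_insertion: "t' \<in> tree_insertions A m t \<Longrightarrow> nodes t' = insert m (nodes t)"
  using mset_labels_insertions(1)[of t' A m t, THEN arg_cong[of _ _ set_mset]]
  by (simp add: nodes_def)

text \<open>A label above all others cannot become a minimum. Hence an insertion into a subtree
  changes neither the status of the edge above it nor the \<alpha>-values of the younger siblings of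
  its root.\<close>

lemma min_label_insertion:
  assumes "t' \<in> tree_insertions A m t" "\<forall>j\<in>nodes t. j < m"
  shows "min_label t' = min_label t"
proof -
  have "min_label t' = min m (min_label t)"
    using nodes_insertion[OF assms(1)] by (simp add: min_label_def)
  then show ?thesis using assms(2) min_label_in[of t] by simp
qed

text \<open>The variable of an interior node depends on its children only through the \<beta>-value
  of the old child, so insertions inside the children preserve it.\<close>

lemma hd_forest_insertion:
  assumes "ts' \<in> forest_insertions A m ts" "\<forall>t\<in>set ts. \<forall>j\<in>nodes t. j < m"
  shows "ts' \<noteq> []" "ts \<noteq> []" "min_label (hd ts') = min_label (hd ts)"
    "length ts' = length ts"
proof -
  have "length ts' = length ts"
    using assms(1) by (induction ts arbitrary: ts') auto
  moreover have "ts \<noteq> []" using assms(1) by auto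
  moreover have "min_label (hd ts') = min_label (hd ts)"
    using assms min_label_insertion by (cases ts) auto
  ultimately show "ts' \<noteq> []" "ts \<noteq> []" "min_label (hd ts') = min_label (hd ts)"
    "length ts' = length ts" by auto
qed

section \<open>Laurent polynomials in the letters that have a rule\<close>

lemma laurent_on_0 [simp]: "0 \<in> laurent_on V"
  by (simp add: laurent_on_def)

lemma laurent_on_1 [simp]: "1 \<in> laurent_on V"
  by (auto simp: laurent_on_def)

lemma laurent_on_add: "p \<in> laurent_on V \<Longrightarrow> q \<in> laurent_on V \<Longrightarrow> p + q \<in> laurent_on V"
  using keys_add[of p q] by (fastforce simp: laurent_on_def)

lemma laurent_on_mult:
  assumes "p \<in> laurent_on V" "q \<in> laurent_on V" shows "p * q \<in> laurent_on V"
proof -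
  have "Poly_Mapping.keys m \<subseteq> V" if m: "m \<in> Poly_Mapping.keys (p * q)" for m
  proof -
    obtain a b where "m = a + b" "a \<in> Poly_Mapping.keys p" "b \<in> Poly_Mapping.keys q"
      using m keys_mult[of p q] by blast
    then show ?thesis using keys_add[of a b] assms by (fastforce simp: laurent_on_def)
  qed
  then show ?thesis by (simp add: laurent_on_def)
qed

lemma laurent_on_sum: "(\<And>i. i \<in> I \<Longrightarrow> f i \<in> laurent_on V) \<Longrightarrow> sum f I \<in> laurent_on V"
  by (induction I rule: infinite_finite_induct) (auto intro: laurent_on_add)

lemma laurent_on_var: "v \<in> V \<Longrightarrow> var v \<in> laurent_on V"
  by (auto simp: laurent_on_def var_def split: if_splits)

lemma dom_grammar:
  "dom (grammar n) = LX ` {1..n} \<union> LY ` {1..n} \<union> {LS, LT}"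
proof -
  have "grammar n v \<noteq> None \<longleftrightarrow> v \<in> LX ` {1..n} \<union> LY ` {1..n} \<union> {LS, LT}" for v
    by (cases v) auto
  then show ?thesis by blast
qed

text \<open>\<open>D\<close> is known to be a derivation only on \<open>L\<close>, so each use of
  the sum and product rules needs its arguments in \<open>L\<close>; \<open>weight_in\<close>
  supplies this for weights.\<close>

locale grammar_derivative =
  fixes m :: nat and D :: "'a::comm_ring_1 laurent \<Rightarrow> 'a laurent"
  assumes deriv: "formal_derivative (grammar m) D"
begin

abbreviation L :: "'a laurent set" where "L \<equiv> laurent_on (dom (grammar m :: 'a grammar))"

lemma D_add: "p \<in> L \<Longrightarrow> q \<in> L \<Longrightarrow> D (p + q) = D p + D q"
  using deriv by (simp add: formal_derivative_def)

lemma D_mult: "p \<in> L \<Longrightarrow> q \<in> L \<Longrightarrow> D (p * q) = D p * q + p * D q"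
  using deriv by (simp add: formal_derivative_def)

lemma D_0: "D 0 = 0"
  using D_add[of 0 0] by simp

lemma D_1: "D 1 = 0"
  using D_mult[of 1 1] by simp

lemma D_sum: "(\<And>i. i \<in> I \<Longrightarrow> f i \<in> L) \<Longrightarrow> D (sum f I) = (\<Sum>i\<in>I. D (f i))"
  by (induction I rule: infinite_finite_induct) (auto simp: D_0 D_add laurent_on_sum)

lemma D_var:
  "k \<in> {1..m} \<Longrightarrow> D (xvar k) = (svar + tvar) * xvar (Suc m) * yvar (Suc m)"
  "k \<in> {1..m} \<Longrightarrow> D (yvar k) = (svar + tvar) * xvar (Suc m) * yvar (Suc m)"
  "D (edge_weight b) = edge_weight b * (svar * xvar (Suc m) + tvar * yvar (Suc m))"
  using deriv by (simp_all add: formal_derivative_def edge_weight_def)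

lemma edge_weight_in: "edge_weight b \<in> L"
  by (auto simp: edge_weight_def dom_grammar intro!: laurent_on_var)

lemma node_weight_in:
  assumes "a \<in> {1..m}" "nodes (Node i ts) \<subseteq> {1..m}"
  shows "node_weight A a i ts \<in> L"
proof (cases ts)
  case Nil
  then show ?thesis
    using assms by (auto simp: node_weight_def dom_grammar nodes_Node intro!: laurent_on_var)
next
  case (Cons t us)
  then have "min_label t \<in> {1..m}" "i \<in> {1..m}"
    using assms min_label_in[of t] by (auto simp: nodes_Node)
  then show ?thesis using Cons
    by (auto simp: node_weight_def dom_grammar intro!: laurent_on_var)
qed

lemma weight_in:
  "a \<in> {1..m} \<Longrightarrow> nodes t \<subseteq> {1..m} \<Longrightarrow> tree_weight A a t \<in> L"
  "a \<in> {1..m} \<Longrightarrow> (\<Union>t\<in>set ts. nodes t) \<subseteq> {1..m} \<Longrightarrow> forest_weight A a ts \<in> L"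
proof (induction A a t and A a ts rule: tree_weight_forest_weight.induct)
  case (1 A a i ts)
  have i: "i \<in> {1..m}" "(\<Union>t\<in>set ts. nodes t) \<subseteq> {1..m}"
    using 1(3) by (auto simp: nodes_Node)
  show ?case
    using node_weight_in[OF 1(2,3)] 1(1)[OF i] by (simp add: laurent_on_mult)
next
  case (3 A a t ts)
  have "min_label t \<in> {1..m}" using 3(4) min_label_in[of t] by auto
  then have "min a (min_label t) \<in> {1..m}" using 3(3) by auto
  then show ?case using 3 by (auto intro!: laurent_on_mult edge_weight_in)
qed simp

end

section \<open>Sums over insertions and the weights of the resulting trees\<close>

lemma sum_insert_positions:
  assumes "\<And>k. k \<in> {1..length cs} \<Longrightarrow> g k = c"
  shows "(\<Sum>k\<in>insert_positions A v cs. g k)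
    = (if v \<in> A then 0 else g 0) + of_nat (length cs) * (c::'a::comm_ring_1)"
proof -
  have "insert_positions A v cs = (if v \<in> A then {} else {0}) \<union> {1..length cs}"
    by (auto simp: insert_positions_def)
  moreover have "(\<Sum>k\<in>{1..length cs}. g k) = of_nat (length cs) * c"
    using assms by simp
  ultimately show ?thesis by simp
qed

context
  fixes m v :: nat and cs :: "ltree list"
  assumes m: "v \<noteq> m" "\<forall>t\<in>set cs. m \<notin> nodes t"
begin

lemma root_neq_new: "t \<in> set cs \<Longrightarrow> root_label t \<noteq> m"
  using m(2) root_label_in_labels[of t] by (auto simp: nodes_def)

lemma inj_insert_leaf: "inj_on (insert_leaf m v cs) {..length cs}"
proof (rule inj_on_inverseI)
  fix k assume k: "k \<in> {..length cs}"
  \<comment> \<open>The position is recovered as the number of children before the one labelled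
    \<open>m\<close>.\<close>
  have "takeWhile (\<lambda>t. root_label t \<noteq> m) (take k cs @ Node m [] # drop k cs) = take k cs"
    using root_neq_new by (subst takeWhile_append2) (auto dest: in_set_takeD)
  then show "length (takeWhile (\<lambda>t. root_label t \<noteq> m) (branches (insert_leaf m v cs k))) = k"
    using k by (simp add: insert_leaf_def)
qed

lemma inj_insert_parent: "inj_on (insert_parent m v cs) {..length cs}"
  by (rule inj_on_inverseI[where g = "\<lambda>t. length (branches (hd (branches t)))"])
    (simp add: insert_parent_def)

lemma sum_tree_insertions:
  "(\<Sum>t\<in>tree_insertions A m (Node v cs). f t) =
     (\<Sum>k\<in>insert_positions A v cs. f (insert_leaf m v cs k))
     + (\<Sum>k\<in>insert_positions A v cs. f (insert_parent m v cs k))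
     + (\<Sum>us\<in>forest_insertions A m cs. f (Node v us))"
proof -
  have sub: "insert_positions A v cs \<subseteq> {..length cs}"
    by (auto simp: insert_positions_def)
  have len: "length us = length cs" if "us \<in> forest_insertions A m cs" for us
    using that by (induction cs arbitrary: us) auto
  have d1: "insert_leaf m v cs ` insert_positions A v cs
      \<inter> insert_parent m v cs ` insert_positions A v cs = {}"
    using m by (auto simp: insert_leaf_def insert_parent_def)
  \<comment> \<open>An inserted leaf lengthens the list of children, which an insertion inside a
    child does not do; an inserted parent changes the root label.\<close>
  have d2: "(insert_leaf m v cs ` insert_positions A v cs
      \<union> insert_parent m v cs ` insert_positions A v cs) \<inter> Node v ` forest_insertions A m cs = {}"
    using m by (auto simp: insert_leaf_def insert_parent_def dest!: len)
  show ?thesis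
    unfolding tree_insertions.simps
    by (subst sum.union_disjoint[OF _ _ d2]; (subst sum.union_disjoint[OF _ _ d1])?)
      (simp_all add: sum.reindex[OF inj_on_subset[OF inj_insert_leaf sub]]
        sum.reindex[OF inj_on_subset[OF inj_insert_parent sub]] sum.reindex[of "Node v"] inj_on_def)
qed

end

lemma sum_forest_insertions:
  assumes "m \<notin> nodes t"
  shows "(\<Sum>us\<in>forest_insertions A m (t # ts). f us) =
     (\<Sum>t'\<in>tree_insertions A m t. f (t' # ts)) + (\<Sum>us\<in>forest_insertions A m ts. f (t # us))"
proof -
  have "t \<notin> tree_insertions A m t"
    using nodes_insertion[of t A m t] assms by blast
  then have "(\<lambda>t'. t' # ts) ` tree_insertions A m t \<inter> (#) t ` forest_insertions A m ts = {}"
    by auto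
  then show ?thesis
    by (simp add: sum.union_disjoint sum.reindex inj_on_def)
qed

context
  fixes A :: "nat set" and a i m k :: nat and cs :: "ltree list"
  assumes m: "m \<notin> A" "a < m" "i < m" "\<forall>t\<in>set cs. \<forall>j\<in>nodes t. j < m" and k: "k \<le> length cs"
begin

text \<open>The \<alpha>-value of the new leaf is below \<open>m\<close>, so its edge is proper and
  its variable is \<open>xvar m\<close>. It does not lower the running minimum, so the siblings
  after it keep their weights. At \<open>k = 0\<close> it becomes the old child of \<open>i\<close>
  and forces the index \<open>m\<close> there.\<close>

lemma weight_insert_leaf:
  "tree_weight A a (insert_leaf m i cs k) =
     (if k = 0 then if i \<in> A then 1 else yvar m else node_weight A a i cs)
     * (svar * xvar m * forest_weight A i cs)"
proof -
  have le: "running_min i us < m" for us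
    using running_min_le[of i us] m(3) by simp
  have s: "forest_weight A i (take k cs @ Node m [] # drop k cs)
      = svar * xvar m * forest_weight A i cs"
    using m le[of "take k cs"]
    by (subst (3) append_take_drop_id[of k cs, symmetric], unfold forest_weight_append)
      (simp add: edge_weight_def node_weight_def min_label_Node algebra_simps)
  have n: "node_weight A a i (take k cs @ Node m [] # drop k cs)
      = (if k = 0 then if i \<in> A then 1 else yvar m else node_weight A a i cs)"
    using k m by (cases cs; cases k) (auto simp: node_weight_def min_label_Node)
  show ?thesis by (simp add: insert_leaf_def s n)
qed

text \<open>The node \<open>i\<close> becomes the old child of \<open>m\<close> with \<alpha>-value
  \<open>m\<close>, which exceeds its \<beta>-value; so this edge is improper and the variable of
  \<open>m\<close> is \<open>yvar m\<close>. The other children of \<open>m\<close> see the same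
  running minimum as before. At \<open>k = 0\<close> the node \<open>i\<close> is a leaf with
  variable \<open>xvar m\<close>, provided it carries one.\<close>

lemma weight_insert_parent:
  assumes "k \<noteq> 0 \<or> i \<notin> A"
  shows "tree_weight A a (insert_parent m i cs k) =
     (if k = 0 then xvar m else node_weight A a i cs)
     * (tvar * yvar m * forest_weight A i cs)"
proof -
  have le: "running_min i us < m" for us
    using running_min_le[of i us] m(3) by simp
  have n: "node_weight A m i (take k cs) = (if k = 0 then xvar m else node_weight A a i cs)"
    using k m assms by (cases cs; cases k) (auto simp: node_weight_def)
  have w: "forest_weight A i cs
      = forest_weight A i (take k cs) * forest_weight A (running_min i (take k cs)) (drop k cs)"
    by (simp flip: forest_weight_append)
  have "tree_weight A a (insert_parent m i cs k)
      = yvar m * (tvar * (node_weight A m i (take k cs) * forest_weight A i (take k cs))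
          * forest_weight A (running_min i (take k cs)) (drop k cs))"
    using m le[of "take k cs"]
    by (simp add: insert_parent_def node_weight_def[of A a] edge_weight_def min_label_Node)
  then show ?thesis by (simp only: w n) (simp add: algebra_simps)
qed

end

section \<open>The derivative of a weight as a sum over insertions\<close>

context grammar_derivative
begin

text \<open>All rules for \<open>xvar k\<close> and \<open>yvar k\<close> share one right-hand side,
  so neither the index nor the kind of the node matters once the index lies in
  \<open>{1..m}\<close>.\<close>

lemma D_node_weight:
  assumes "a \<in> {1..m}" "nodes (Node i ts) \<subseteq> {1..m}"
  shows "D (node_weight A a i ts)
    = (if i \<in> A then 0 else (svar + tvar) * xvar (Suc m) * yvar (Suc m))"
proof (cases ts)
  case Nil
  then show ?thesis
    using assms by (auto simp: node_weight_def nodes_Node D_1 max_def intro!: D_var)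
next
  case (Cons t us)
  then have "min_label t \<in> {1..m}" "i \<in> {1..m}"
    using assms min_label_in[of t] by (auto simp: nodes_Node)
  then show ?thesis using Cons
    by (auto simp: node_weight_def D_1 max_def intro!: D_var)
qed

text \<open>The edges to the members of a forest carry weights too. The derivative of such an edge
  weight stands for a position \<open>k > 0\<close> at the common parent, which is not an insertion
  into the forest; this is the extra term with \<open>length ts\<close>. In a tree, the positions at
  the root absorb that term.\<close>

lemma D_weight:
  "Suc m \<notin> A \<Longrightarrow> a \<in> {1..m} \<Longrightarrow> nodes t \<subseteq> {1..m} \<Longrightarrow>
     D (tree_weight A a t) = (\<Sum>u\<in>tree_insertions A (Suc m) t. tree_weight A a u)"
  "Suc m \<notin> A \<Longrightarrow> a \<in> {1..m} \<Longrightarrow> (\<Union>t\<in>set ts. nodes t) \<subseteq> {1..m} \<Longrightarrow>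
     D (forest_weight A a ts) = (\<Sum>us\<in>forest_insertions A (Suc m) ts. forest_weight A a us)
       + of_nat (length ts) * ((svar * xvar (Suc m) + tvar * yvar (Suc m)) * forest_weight A a ts)"
proof (induction A a t and A a ts rule: tree_weight_forest_weight.induct)
  case (1 A a i ts)
  have i: "i \<in> {1..m}" "(\<Union>t\<in>set ts. nodes t) \<subseteq> {1..m}"
    using 1(4) by (auto simp: nodes_Node)
  have lt: "a < Suc m" "i < Suc m" "\<forall>t\<in>set ts. \<forall>j\<in>nodes t. j < Suc m"
    using 1(3) i by (auto simp: subset_iff less_Suc_eq_le)
  note leaf = weight_insert_leaf[OF 1(2) lt]
  note par = weight_insert_parent[OF 1(2) lt]
  let ?W = "node_weight A a i ts :: 'a laurent" and ?V = "forest_weight A i ts :: 'a laurent"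
  let ?x = "xvar (Suc m) :: 'a laurent" and ?y = "yvar (Suc m) :: 'a laurent"
  have A: "(\<Sum>k\<in>insert_positions A i ts. tree_weight A a (insert_leaf (Suc m) i ts k))
      = (if i \<in> A then 0 else ?y * (svar * ?x * ?V)) + of_nat (length ts) * (?W * (svar * ?x * ?V))"
    by (subst sum_insert_positions[where c = "?W * (svar * ?x * ?V)"]) (auto simp: leaf)
  have B: "(\<Sum>k\<in>insert_positions A i ts. tree_weight A a (insert_parent (Suc m) i ts k))
      = (if i \<in> A then 0 else ?x * (tvar * ?y * ?V)) + of_nat (length ts) * (?W * (tvar * ?y * ?V))"
    by (subst sum_insert_positions[where c = "?W * (tvar * ?y * ?V)"]) (auto simp: par)
  have C: "(\<Sum>us\<in>forest_insertions A (Suc m) ts. tree_weight A a (Node i us))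
      = ?W * (\<Sum>us\<in>forest_insertions A (Suc m) ts. forest_weight A i us)"
    using hd_forest_insertion[OF _ lt(3), of _ A]
    by (auto simp: sum_distrib_left node_weight_def intro!: sum.cong)
  have S: "(\<Sum>u\<in>tree_insertions A (Suc m) (Node i ts). tree_weight A a u :: 'a laurent) =
     (\<Sum>k\<in>insert_positions A i ts. tree_weight A a (insert_leaf (Suc m) i ts k))
     + (\<Sum>k\<in>insert_positions A i ts. tree_weight A a (insert_parent (Suc m) i ts k))
     + (\<Sum>us\<in>forest_insertions A (Suc m) ts. tree_weight A a (Node i us))"
    using lt by (intro sum_tree_insertions) auto
  have "D (tree_weight A a (Node i ts)) = D ?W * ?V + ?W * D ?V"
    using node_weight_in[OF 1(3,4)] weight_in(2)[OF i] by (simp add: D_mult)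
  \<comment> \<open>The two terms for position 0 add up to the derivative of the node weight, and
    the multiples of \<open>length ts\<close> match the extra term of the forest.\<close>
  then show ?case
    unfolding S A B C D_node_weight[OF 1(3,4)] 1(1)[OF 1(2) i]
    by (simp add: algebra_simps)
next
  case (3 A a t ts)
  have min: "min_label t \<in> {1..m}" using 3(5) min_label_in[of t] by auto
  then have a': "min a (min_label t) \<in> {1..m}" using 3(4) by auto
  have sub: "nodes t \<subseteq> {1..m}" "(\<Union>t\<in>set ts. nodes t) \<subseteq> {1..m}" using 3(5) by auto
  have lt: "\<forall>j\<in>nodes t. j < Suc m" "Suc m \<notin> nodes t"
    using sub by (auto simp: subset_iff less_Suc_eq_le)
  let ?e = "edge_weight (a < min_label t) :: 'a laurent"
  let ?T = "tree_weight A a t :: 'a laurent"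
  let ?U = "forest_weight A (min a (min_label t)) ts :: 'a laurent"
  \<comment> \<open>The edge weight and the remaining members depend on \<open>t\<close> only
    through \<open>min_label t\<close>, which is unchanged.\<close>
  have "(\<Sum>t'\<in>tree_insertions A (Suc m) t. forest_weight A a (t' # ts))
      = ?e * D ?T * ?U"
    by (simp add: 3(1)[OF 3(3,4) sub(1)] sum_distrib_left sum_distrib_right
        min_label_insertion[OF _ lt(1)])
  moreover have "(\<Sum>us\<in>forest_insertions A (Suc m) ts. forest_weight A a (t # us))
      = ?e * ?T * (\<Sum>us\<in>forest_insertions A (Suc m) ts. forest_weight A (min a (min_label t)) us)"
    by (simp add: sum_distrib_left)
  moreover have "D (forest_weight A a (t # ts)) = (D ?e * ?T + ?e * D ?T) * ?U + ?e * ?T * D ?U"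
    using weight_in(1)[OF 3(4) sub(1)] weight_in(2)[OF a' sub(2)]
    by (simp add: D_mult laurent_on_mult edge_weight_in)
  ultimately show ?case
    unfolding 3(2)[OF 3(3) a' sub(2)] D_var sum_forest_insertions[OF lt(2)]
    by (simp add: algebra_simps)
qed (simp add: D_1)

end

section \<open>Removal of the largest label\<close>

fun tree_removal :: "nat \<Rightarrow> ltree \<Rightarrow> ltree"
  and forest_removal :: "nat \<Rightarrow> ltree list \<Rightarrow> ltree list" where
  "tree_removal m (Node v cs) =
     (if v = m then (case cs of [] \<Rightarrow> Node v [] | c # es \<Rightarrow> Node (root_label c) (branches c @ es))
      else Node v (forest_removal m cs))"
| "forest_removal m [] = []"
| "forest_removal m (t # ts) =
     (if t = Node m [] then ts else tree_removal m t # forest_removal m ts)"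

lemma removal_id:
  "m \<notin> nodes t \<Longrightarrow> tree_removal m t = t"
  "m \<notin> (\<Union>t\<in>set ts. nodes t) \<Longrightarrow> forest_removal m ts = ts"
proof (induction m t and m ts rule: tree_removal_forest_removal.induct)
  case (1 m v cs)
  then show ?case by (simp add: nodes_Node)
next
  case (3 m t ts)
  then have "t \<noteq> Node m []" by (auto simp: nodes_Node)
  then show ?case using 3 by simp
qed simp

lemma forest_removal_append:
  "m \<notin> (\<Union>t\<in>set ts. nodes t) \<Longrightarrow> forest_removal m (ts @ us) = ts @ forest_removal m us"
  by (induction ts) (auto simp: nodes_Node removal_id)

text \<open>Removal depends neither on \<open>A\<close> nor on the chosen position, so the result of
  an insertion determines its source; this makes the insertion sets of different trees
  disjoint.\<close>

lemma removal_insertion: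
  "t' \<in> tree_insertions A m t \<Longrightarrow> m \<notin> nodes t \<Longrightarrow> tree_removal m t' = t"
  "ts' \<in> forest_insertions A m ts \<Longrightarrow> m \<notin> (\<Union>t\<in>set ts. nodes t) \<Longrightarrow> forest_removal m ts' = ts"
proof (induction A m t and A m ts arbitrary: t' and ts' rule: tree_insertions_forest_insertions.induct)
  case (1 A m v cs)
  have v: "v \<noteq> m" "m \<notin> (\<Union>t\<in>set cs. nodes t)" using 1(3) by (auto simp: nodes_Node)
  then have "m \<notin> (\<Union>t\<in>set (take k cs). nodes t)" for k
    by (auto dest: in_set_takeD)
  then show ?case
    using 1(1,2) v by (auto simp: insert_leaf_def insert_parent_def forest_removal_append)
next
  case (3 A m t ts)
  have t: "m \<notin> nodes t" "m \<notin> (\<Union>t\<in>set ts. nodes t)" using 3(4) by auto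
  \<comment> \<open>A changed child still has the labels of \<open>t\<close>, so
    \<open>forest_removal\<close> does not mistake it for an inserted leaf.\<close>
  have "t' \<noteq> Node m []" if "t' \<in> tree_insertions A m t" for t'
    using nodes_insertion[OF that] t(1) nodes_ne[of t] by (auto simp: nodes_Node subset_singleton_iff)
  then show ?case
    using 3 t by (auto simp: removal_id nodes_Node)
qed simp

lemma forest_insertion_iff:
  "ts' \<in> forest_insertions A m ts \<longleftrightarrow>
     (\<exists>xs t t' ys. ts = xs @ t # ys \<and> ts' = xs @ t' # ys \<and> t' \<in> tree_insertions A m t)"
proof (induction ts arbitrary: ts')
  case (Cons u us)
  show ?case (is "?L \<longleftrightarrow> ?R")
  proof
    assume ?L
    then consider t' where "ts' = t' # us" "t' \<in> tree_insertions A m u"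
      | us' where "ts' = u # us'" "us' \<in> forest_insertions A m us"
      by auto
    then show ?R
    proof cases
      case 1
      then have "u # us = [] @ u # us \<and> ts' = [] @ t' # us \<and> t' \<in> tree_insertions A m u"
        by simp
      then show ?thesis by blast
    next
      case 2
      then obtain xs t t' ys where "us = xs @ t # ys" "us' = xs @ t' # ys"
        "t' \<in> tree_insertions A m t"
        using Cons by blast
      then have "u # us = (u # xs) @ t # ys \<and> ts' = (u # xs) @ t' # ys
          \<and> t' \<in> tree_insertions A m t"
        using 2 by simp
      then show ?thesis by blast
    qed
  next
    assume ?R
    then obtain xs t t' ys where *: "u # us = xs @ t # ys" "ts' = xs @ t' # ys"
      "t' \<in> tree_insertions A m t"
      by blast
    show ?L
    proof (cases xs)
      case Nil
      then show ?thesis using * by simp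
    next
      case (Cons x xs')
      then have "xs' @ t' # ys \<in> forest_insertions A m us"
        using * Cons.IH by auto
      then show ?thesis using * Cons by auto
    qed
  qed
qed simp

text \<open>Descent towards \<open>m\<close> finds the choice to undo: an interior \<open>m\<close>
  is merged with its old child, a leaf \<open>m\<close> is deleted from its parent. The tree
  consisting of \<open>m\<close> alone has no source.\<close>

lemma insertion_exists:
  "distinct (labels t') \<Longrightarrow> m \<in> nodes t' \<Longrightarrow> t' \<noteq> Node m [] \<Longrightarrow>
     \<exists>t. m \<notin> nodes t \<and> t' \<in> tree_insertions {} m t"
proof (induction t')
  case (Node v cs)
  show ?case
  proof (cases "v = m")
    case True
    then obtain w ds es where cs: "cs = Node w ds # es"
      using Node.prems(3) by (metis list.exhaust ltree.exhaust)
    have "Node v cs = insert_parent m w (ds @ es) (length ds)"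
      by (simp add: cs True insert_parent_def)
    then have "Node v cs \<in> tree_insertions {} m (Node w (ds @ es))"
      by (auto simp: insert_positions_def)
    moreover have "m \<notin> nodes (Node w (ds @ es))"
      using Node.prems(1) True by (auto simp: cs nodes_def)
    ultimately show ?thesis by blast
  next
    case False
    then obtain c where "c \<in> set cs" "m \<in> nodes c"
      using Node.prems(2) by (auto simp: nodes_Node)
    then obtain xs ys where cs: "cs = xs @ c # ys" by (meson split_list)
    have not: "m \<notin> nodes t" if "t \<in> set xs \<union> set ys" for t
      using Node.prems(1) \<open>m \<in> nodes c\<close> that by (auto simp: cs nodes_def)
    show ?thesis
    proof (cases "c = Node m []")
      case True
      have "Node v cs = insert_leaf m v (xs @ ys) (length xs)"
        by (simp add: cs True insert_leaf_def)
      then have "Node v cs \<in> tree_insertions {} m (Node v (xs @ ys))"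
        by (auto simp: insert_positions_def)
      moreover have "m \<notin> nodes (Node v (xs @ ys))"
        using not False by (auto simp: nodes_Node)
      ultimately show ?thesis by blast
    next
      case c: False
      have "distinct (labels c)"
        using Node.prems(1) by (simp add: cs)
      then obtain d where d: "m \<notin> nodes d" "c \<in> tree_insertions {} m d"
        using Node.IH[OF \<open>c \<in> set cs\<close>] \<open>m \<in> nodes c\<close> c by blast
      then have "cs \<in> forest_insertions {} m (xs @ d # ys)"
        using cs by (auto simp: forest_insertion_iff)
      moreover have "m \<notin> nodes (Node v (xs @ d # ys))"
        using not False d by (auto simp: nodes_Node)
      ultimately show ?thesis by fastforce
    qed
  qed
qed

lemma labeled_trees_iff: "T \<in> labeled_trees m \<longleftrightarrow> mset (labels T) = mset_set {1..m}"
proof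
  assume "T \<in> labeled_trees m"
  then show "mset (labels T) = mset_set {1..m}"
    using mset_set_set[of "labels T"] by (simp add: labeled_trees_def nodes_def)
next
  assume *: "mset (labels T) = mset_set {1..m}"
  then have "set_mset (mset (labels T)) = set_mset (mset_set {1..m})" by simp
  then have "nodes T = {1..m}" by (simp add: nodes_def)
  moreover have "distinct (labels T)"
    unfolding distinct_count_atmost_1 * using \<open>nodes T = {1..m}\<close>
    by (simp add: nodes_def count_mset_set')
  ultimately show "T \<in> labeled_trees m"
    by (simp add: labeled_trees_def)
qed

lemma insertion_labeled_trees:
  assumes "T' \<in> tree_insertions A (Suc m) T"
  shows "T' \<in> labeled_trees (Suc m) \<longleftrightarrow> T \<in> labeled_trees m"
proof -
  have "mset_set {1..Suc m} = add_mset (Suc m) (mset_set {1..m})"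
    by (simp add: atLeastAtMostSuc_conv)
  then show ?thesis
    using mset_labels_insertions(1)[OF assms] by (simp add: labeled_trees_iff)
qed

lemma labeled_trees_Suc:
  assumes "m \<ge> 1"
  shows "labeled_trees (Suc m) = (\<Union>T\<in>labeled_trees m. tree_insertions {} (Suc m) T)"
proof -
  have "\<exists>T. T' \<in> tree_insertions {} (Suc m) T" if T': "T' \<in> labeled_trees (Suc m)" for T'
  proof -
    have *: "distinct (labels T')" "nodes T' = {1..Suc m}"
      using T' by (auto simp: labeled_trees_def)
    then have new: "Suc m \<in> nodes T'" and "1 \<in> nodes T'" by auto
    \<comment> \<open>By the bound on \<open>m\<close>, label 1 differs from the new label, which
      excludes the tree without a source.\<close>
    then have "T' \<noteq> Node (Suc m) []" using assms by (auto simp: nodes_Node)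
    then show ?thesis using insertion_exists[OF *(1) new] by blast
  qed
  then show ?thesis by (auto simp: insertion_labeled_trees) (metis insertion_labeled_trees)
qed

lemma sum_insertions:
  assumes "X \<subseteq> labeled_trees m"
  shows "(\<Sum>T'\<in>(\<Union>T\<in>X. tree_insertions A (Suc m) T). f T')
    = (\<Sum>T\<in>X. \<Sum>T'\<in>tree_insertions A (Suc m) T. f T')"
proof (rule sum.UNION_disjoint)
  have "Suc m \<notin> nodes T" if "T \<in> X" for T
    using assms that by (auto simp: labeled_trees_def)
  then show "\<forall>T\<in>X. \<forall>U\<in>X. T \<noteq> U \<longrightarrow>
      tree_insertions A (Suc m) T \<inter> tree_insertions A (Suc m) U = {}"
    using removal_insertion(1) by blast
qed (use assms finite_subset[OF _ finite_labeled_trees] in auto)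

context grammar_derivative
begin

text \<open>The root has no \<alpha>-value; 1 is a placeholder that keeps the index in
  range.\<close>

lemma D_sum_tree_weight:
  assumes "X \<subseteq> labeled_trees m" "Suc m \<notin> A" "m \<ge> 1"
  shows "D (\<Sum>T\<in>X. tree_weight A 1 T)
    = (\<Sum>T\<in>(\<Union>T\<in>X. tree_insertions A (Suc m) T). tree_weight A 1 T)"
proof -
  have *: "nodes T \<subseteq> {1..m}" if "T \<in> X" for T
    using assms(1) that by (auto simp: labeled_trees_def)
  then have "D (\<Sum>T\<in>X. tree_weight A 1 T) = (\<Sum>T\<in>X. D (tree_weight A 1 T))"
    using assms(3) by (intro D_sum weight_in) auto
  also have "\<dots> = (\<Sum>T\<in>X. \<Sum>T'\<in>tree_insertions A (Suc m) T. tree_weight A 1 T')"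
    using * assms by (intro sum.cong D_weight refl) auto
  finally show ?thesis by (simp add: sum_insertions[OF assms(1)])
qed

end

section \<open>Comparison of the recursive weight with the product over nodes and edges\<close>

lemma subtree_refl [simp]: "t \<in> subtrees t"
  by (cases t) simp

lemma subtree_trans: "t \<in> subtrees u \<Longrightarrow> u \<in> subtrees T \<Longrightarrow> t \<in> subtrees T"
  by (induction T rule: subtrees.induct) auto

lemma branch_subtree: "Node i cs \<in> subtrees T \<Longrightarrow> c \<in> set cs \<Longrightarrow> c \<in> subtrees T"
  by (rule subtree_trans[of _ "Node i cs"]) (auto intro: bexI[of _ c])

lemma size_subtree: "t \<in> subtrees T \<Longrightarrow> size t \<le> size T"
proof (induction T rule: subtrees.induct)
  case (1 i ts)
  then show ?case
    by (auto dest!: size_list_estimation'[of _ ts "size t" size, rotated] simp: le_Suc_eq)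
qed

lemma size_branch: "c \<in> set cs \<Longrightarrow> size c < size (Node i cs)"
  by (induction cs) auto

lemma root_in_nodes [simp]: "root_label t \<in> nodes t"
  using root_label_in_labels by (simp add: nodes_def)

lemma subtree_nodes: "t \<in> subtrees T \<Longrightarrow> nodes t \<subseteq> nodes T"
  using subtrees_labels by (simp add: nodes_def)

lemma running_min_eq_Min: "running_min a ts = Min (insert a (min_label ` set ts))"
proof (induction ts arbitrary: a)
  case (Cons t ts)
  then show ?case
    by (cases "set ts = {}") (simp_all add: ac_simps)
qed simp

lemma distinct_root_labels:
  "distinct (concat (map labels ts)) \<Longrightarrow> distinct (map root_label ts)"
proof (induction ts)
  case (Cons t ts)
  have "root_label t \<noteq> root_label u" if "u \<in> set ts" for u
    using Cons.prems that root_label_in_labels[of t] root_label_in_labels[of u] by auto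
  then show ?case using Cons by auto
qed simp

lemma nonroot_parent:
  "j \<in> nodes t \<Longrightarrow> j \<noteq> root_label t \<Longrightarrow>
     \<exists>i cs. Node i cs \<in> subtrees t \<and> j \<in> root_label ` set cs"
proof (induction t)
  case (Node v ds)
  then obtain d where d: "d \<in> set ds" "j \<in> nodes d" by (auto simp: nodes_Node)
  show ?case
  proof (cases "j = root_label d")
    case True
    then have "Node v ds \<in> subtrees (Node v ds) \<and> j \<in> root_label ` set ds"
      using d by auto
    then show ?thesis by blast
  next
    case False
    then obtain i cs where "Node i cs \<in> subtrees d" "j \<in> root_label ` set cs"
      using Node.IH[OF d] by blast
    moreover from this have "Node i cs \<in> subtrees (Node v ds)" using d(1) by auto
    ultimately show ?thesis by blast
  qed
qed

lemma distinct_subtree: "t \<in> subtrees T \<Longrightarrow> distinct (labels T) \<Longrightarrow> distinct (labels t)"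
  by (induction T rule: subtrees.induct) (auto simp: distinct_branch)

context
  fixes T :: ltree
  assumes distinct: "distinct (labels T)"
begin

lemma children_eq: "Node i cs \<in> subtrees T \<Longrightarrow> children T i = map root_label cs"
  using subtree_at_eq[OF distinct] by (fastforce simp: children_def)

lemma beta_eq: "t \<in> subtrees T \<Longrightarrow> beta T (root_label t) = min_label t"
  by (simp add: beta_def min_label_def subtree_at_eq[OF distinct])

lemma edge_iff:
  "(i, j) \<in> edges T \<longleftrightarrow> (\<exists>cs. Node i cs \<in> subtrees T \<and> j \<in> root_label ` set cs)"
proof
  assume *: "(i, j) \<in> edges T"
  then obtain t where t: "t \<in> subtrees T" "root_label t = i"
    using subtree_ex[of i T] by (auto simp: edges_def nodes_def)
  obtain cs where "t = Node i cs" using t(2) by (cases t) auto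
  then show "\<exists>cs. Node i cs \<in> subtrees T \<and> j \<in> root_label ` set cs"
    using * t children_eq by (auto simp: edges_def)
next
  assume "\<exists>cs. Node i cs \<in> subtrees T \<and> j \<in> root_label ` set cs"
  then obtain cs where *: "Node i cs \<in> subtrees T" "j \<in> root_label ` set cs" by blast
  then have "i \<in> nodes T" using subtree_nodes[OF *(1)] by (auto simp: nodes_Node)
  then show "(i, j) \<in> edges T" using * children_eq by (simp add: edges_def)
qed

lemma parent_eq: "(i, j) \<in> edges T \<Longrightarrow> parent T j = i"
  unfolding parent_def using parent_unique[OF distinct] by blast

lemma alpha_eq:
  assumes "Node i (xs @ c # ys) \<in> subtrees T"
  shows "alpha T (root_label c) = running_min i xs"
proof -
  have d: "distinct (map root_label (xs @ c # ys))"
    using distinct_subtree[OF assms distinct] by (intro distinct_root_labels) simp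
  have p: "parent T (root_label c) = i"
    using assms by (intro parent_eq) (auto simp: edge_iff)
  have "root_label c \<notin> set (map root_label xs)" using d by simp
  then have "k \<noteq> root_label c" if "k \<in> set (map root_label xs)" for k
    using that by metis
  \<comment> \<open>Siblings have distinct labels, so the search for \<open>c\<close> passes over
    exactly \<open>xs\<close>.\<close>
  then have "takeWhile (\<lambda>k. k \<noteq> root_label c) (map root_label (xs @ c # ys)) = map root_label xs"
    by (subst map_append, subst takeWhile_append2) auto
  then have "elder_siblings T (root_label c) = root_label ` set xs"
    by (simp add: elder_siblings_def p children_eq[OF assms])
  moreover have "beta T (root_label x) = min_label x" if "x \<in> set xs" for x
    using branch_subtree[OF assms] that by (intro beta_eq) auto
  ultimately show ?thesis
    by (simp add: alpha_def p running_min_eq_Min image_image)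
qed

lemma leaf_iff: "Node i cs \<in> subtrees T \<Longrightarrow> i \<in> leaves T \<longleftrightarrow> cs = []"
  using subtree_nodes[of "Node i cs" T] by (auto simp: leaves_def children_eq nodes_Node)

lemma node_weight_eq:
  assumes "Node i cs \<in> subtrees T" "cs \<noteq> [] \<or> a = alpha T i"
  shows "node_weight A a i cs = (if i \<in> A then 1
    else if i \<in> leaves T then xvar (node_index T i) else yvar (node_index T i))"
proof (cases cs)
  case (Cons c ds)
  then have "beta T (old_child T i) = min_label c"
    using children_eq[OF assms(1)] beta_eq branch_subtree[OF assms(1), of c]
    by (simp add: old_child_def)
  then show ?thesis
    using Cons leaf_iff[OF assms(1)] by (simp add: node_weight_def node_index_def)
qed (use assms leaf_iff[OF assms(1)] in \<open>simp add: node_weight_def node_index_def\<close>)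

text \<open>Each node other than the root is paired with the edge above it. The product runs along
  the preorder list of labels, as the recursion does, and becomes a product over sets only
  afterwards.\<close>

lemma tree_weight_prod_list:
  fixes A
  defines "g j \<equiv> (if j \<in> A then 1
    else if j \<in> leaves T then xvar (node_index T j) else yvar (node_index T j))"
    and "e j \<equiv> edge_weight (alpha T j < beta T j)"
  assumes "t \<in> subtrees T" "branches t \<noteq> [] \<or> a = alpha T (root_label t)"
  shows "tree_weight A a t = g (root_label t) * prod_list (map (\<lambda>j. e j * g j) (tl (labels t)))"
  using assms(3,4)
proof (induction t arbitrary: a)
  case (Node i cs)
  \<comment> \<open>Generalised over the children \<open>xs\<close> already passed, since the
    parameter of \<open>forest_weight\<close> is then the \<alpha>-value of the next child.\<close>
  have "forest_weight A (running_min i xs) ys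
      = prod_list (map (\<lambda>j. e j * g j) (concat (map labels ys)))" if "cs = xs @ ys" for xs ys
    using that
  proof (induction ys arbitrary: xs)
    case (Cons y ys)
    have N: "Node i (xs @ y # ys) \<in> subtrees T" using Node.prems(1) Cons.prems by simp
    have y: "y \<in> subtrees T" using branch_subtree[OF N] by simp
    have l: "labels y = root_label y # tl (labels y)" by (cases y) simp
    have "tree_weight A (running_min i xs) y
        = g (root_label y) * prod_list (map (\<lambda>j. e j * g j) (tl (labels y)))"
      using Node.IH[of y "running_min i xs"] y alpha_eq[OF N] Cons.prems by simp
    moreover have "edge_weight (running_min i xs < min_label y) = e (root_label y)"
      using alpha_eq[OF N] beta_eq[OF y] by (simp add: e_def)
    moreover have "forest_weight A (min (running_min i xs) (min_label y)) ys
        = prod_list (map (\<lambda>j. e j * g j) (concat (map labels ys)))"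
      using Cons.IH[of "xs @ [y]"] Cons.prems by simp
    ultimately show ?case
      by (subst list.map, subst concat.simps, subst l) (simp add: mult_ac)
  qed simp
  from this[of "[]" cs] have "forest_weight A i cs
      = prod_list (map (\<lambda>j. e j * g j) (concat (map labels cs)))" by simp
  moreover have "node_weight A a i cs = g i"
    using node_weight_eq[OF Node.prems(1), of a A] Node.prems(2) by (simp add: g_def)
  ultimately show ?case by simp
qed

text \<open>By \<open>parent_unique\<close> an edge is identified by its child end, so counting
  edges amounts to counting nodes other than the root.\<close>

lemma snd_edges: "snd ` edges T = nodes T - {root_label T}"
proof -
  have "j \<in> nodes T \<and> j \<noteq> root_label T" if edge: "(i, j) \<in> edges T" for i j
  proof -
    obtain cs c where c: "Node i cs \<in> subtrees T" "c \<in> set cs" "j = root_label c"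
      using edge by (auto simp: edge_iff)
    have "c \<in> subtrees T" using branch_subtree c by blast
    moreover have "c \<noteq> T"
      using size_subtree[OF c(1)] size_branch[OF c(2), of i] by auto
    ultimately show ?thesis
      using subtree_inj[OF distinct, of c T] subtree_nodes[of c T] c(3) root_in_nodes by auto
  qed
  moreover have "j \<in> snd ` edges T" if "j \<in> nodes T - {root_label T}" for j
    using nonroot_parent[of j T] that edge_iff by force
  ultimately show ?thesis by auto
qed

lemma imp_eq: "imp T = card {j \<in> nodes T - {root_label T}. \<not> alpha T j < beta T j}"
proof -
  have "inj_on snd (improper_edges T)"
    using parent_unique[OF distinct] by (auto simp: inj_on_def improper_edges_def)
  moreover have "snd ` improper_edges T
      = {j \<in> nodes T - {root_label T}. \<not> alpha T j < beta T j}"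
    unfolding snd_edges[symmetric] improper_edges_def by force
  ultimately show ?thesis by (metis imp_def card_image)
qed

lemma prod_edge_weight:
  "(\<Prod>j\<in>nodes T - {root_label T}. edge_weight (alpha T j < beta T j))
     = svar ^ (card (nodes T) - 1 - imp T) * tvar ^ imp T"
proof -
  let ?N = "nodes T - {root_label T}"
  have "card ?N = card (nodes T) - 1" by simp
  moreover have "?N = ?N \<inter> {j. alpha T j < beta T j} \<union> ?N \<inter> - {j. alpha T j < beta T j}"
    by blast
  then have "card ?N = card (?N \<inter> {j. alpha T j < beta T j})
      + card (?N \<inter> - {j. alpha T j < beta T j})"
    by (metis (no_types, lifting) card_Un_disjoint finite_Diff finite_Int finite_nodes
        Int_assoc Int_left_commute Compl_disjoint Int_empty_right)
  moreover have imp: "imp T = card (?N \<inter> - {j. alpha T j < beta T j})"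
    unfolding imp_eq by (auto intro: arg_cong[where f = card])
  ultimately have "card (nodes T) - 1 - imp T = card (?N \<inter> {j. alpha T j < beta T j})"
    by linarith
  then show ?thesis
    unfolding imp by (simp add: edge_weight_def prod.If_cases)
qed

text \<open>A root with children is not a leaf, so its weight ignores the placeholder
  \<open>a\<close>.\<close>

lemma tree_weight_eq:
  assumes "branches T \<noteq> []"
  shows "tree_weight A a T = svar ^ (card (nodes T) - 1 - imp T) * tvar ^ imp T
    * (\<Prod>i\<in>leaves T - A. xvar (node_index T i))
    * (\<Prod>j\<in>interior_nodes T - A. yvar (node_index T j))"
proof -
  define g :: "nat \<Rightarrow> 'a laurent" where "g j = (if j \<in> A then 1
    else if j \<in> leaves T then xvar (node_index T j) else yvar (node_index T j))" for j
  define e :: "nat \<Rightarrow> 'a laurent" where "e j = edge_weight (alpha T j < beta T j)" for j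
  have l: "labels T = root_label T # tl (labels T)" by (cases T) simp
  then have r: "root_label T \<notin> set (tl (labels T))" "distinct (tl (labels T))"
    using distinct by (metis distinct.simps(2))+
  have s: "nodes T = insert (root_label T) (set (tl (labels T)))"
    unfolding nodes_def by (metis l list.simps(15))
  have N: "set (tl (labels T)) = nodes T - {root_label T}"
    using s r by auto
  have "tree_weight A a T = g (root_label T) * prod_list (map (\<lambda>j. e j * g j) (tl (labels T)))"
    using tree_weight_prod_list[of T a A] assms by (simp add: g_def e_def)
  also have "\<dots> = g (root_label T) * (\<Prod>j\<in>nodes T - {root_label T}. e j * g j)"
    using r(2) N by (simp add: prod.distinct_set_conv_list[symmetric])
  also have "\<dots> = (\<Prod>j\<in>nodes T - {root_label T}. e j) * (\<Prod>j\<in>nodes T. g j)"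
    by (simp add: prod.remove[of "nodes T" "root_label T" g] prod.distrib mult_ac)
  also have "(\<Prod>j\<in>nodes T. g j) = (\<Prod>j\<in>(leaves T - A) \<union> (interior_nodes T - A). g j)"
    by (rule prod.mono_neutral_right) (auto simp: leaves_def interior_nodes_def g_def)
  also have "\<dots> = (\<Prod>j\<in>leaves T - A. g j) * (\<Prod>j\<in>interior_nodes T - A. g j)"
    by (rule prod.union_disjoint)
      (auto simp: leaves_def interior_nodes_def intro: finite_subset[OF _ finite_nodes[of T]])
  also have "(\<Prod>j\<in>leaves T - A. g j) = (\<Prod>i\<in>leaves T - A. xvar (node_index T i))"
    by (rule prod.cong) (auto simp: g_def)
  also have "(\<Prod>j\<in>interior_nodes T - A. g j) = (\<Prod>i\<in>interior_nodes T - A. yvar (node_index T i))"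
    by (rule prod.cong) (auto simp: g_def interior_nodes_def leaves_def)
  finally show ?thesis
    by (simp add: e_def prod_edge_weight mult_ac)
qed

end

section \<open>Star trees under insertion\<close>

definition star_children :: "nat \<Rightarrow> nat list \<Rightarrow> bool" where
  "star_children v rs \<longleftrightarrow> (v = 1 \<longrightarrow> rs = []) \<and>
     (v = 2 \<longrightarrow> rs \<noteq> [] \<and> hd rs = 1 \<and> 1 \<notin> set (tl rs)) \<and> (v \<noteq> 2 \<longrightarrow> 1 \<notin> set rs)"

text \<open>A characterization of the star trees by conditions on each node separately, which can be
  followed through an insertion.\<close>

fun star_tree :: "ltree \<Rightarrow> bool" where
  "star_tree (Node v cs) \<longleftrightarrow> star_children v (map root_label cs) \<and> (\<forall>c\<in>set cs. star_tree c)"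

text \<open>Only a parent inserted above the root changes the root label, and the old root is then
  still visible as a child. This tracks whether a child labelled 1 stays in place.\<close>

lemma root_label_insertion:
  "t' \<in> tree_insertions A m t \<Longrightarrow> root_label t' = root_label t \<or>
     root_label t' = m \<and> root_label t \<in> root_label ` set (branches t')"
  by (cases t) (auto simp: insert_leaf_def insert_parent_def)

text \<open>Node 1 is childless, so without position 0 nothing is inserted at it; at node 2 a
  position \<open>k > 0\<close> keeps 1 as its first child. The new label is neither 1 nor
  2.\<close>

lemma star_tree_insertion:
  "star_tree t \<Longrightarrow> t' \<in> tree_insertions {1, 2} m t \<Longrightarrow> 3 \<le> m \<Longrightarrow> star_tree t'"
proof (induction t arbitrary: t')
  case (Node v cs)
  have star: "star_children v (map root_label cs)" "\<forall>c\<in>set cs. star_tree c"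
    using Node.prems(1) by auto
  consider k where "k \<in> insert_positions {1, 2} v cs" "t' = insert_leaf m v cs k"
    | k where "k \<in> insert_positions {1, 2} v cs" "t' = insert_parent m v cs k"
    | us where "us \<in> forest_insertions {1, 2} m cs" "t' = Node v us"
    using Node.prems(2) by auto
  then show ?case
  proof cases
    case (1 k)
    then have "star_children v (map root_label (take k cs @ Node m [] # drop k cs))"
      using star(1) Node.prems(3)
      by (cases cs; cases k)
        (auto simp: star_children_def insert_positions_def dest: in_set_takeD in_set_dropD)
    then show ?thesis
      using 1 star(2) Node.prems(3)
      by (auto simp: insert_leaf_def star_children_def[of m] dest: in_set_takeD in_set_dropD)
  next
    case (2 k)
    then have "star_children v (map root_label (take k cs))"
      "star_children m (v # map root_label (drop k cs))"
      using star(1) Node.prems(3)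
      by (cases cs; cases k; auto simp: star_children_def insert_positions_def
          dest: in_set_takeD in_set_dropD)+
    then show ?thesis
      using 2 star(2) by (auto simp: insert_parent_def dest: in_set_takeD in_set_dropD)
  next
    case (3 us)
    then obtain xs t u ys where cs: "cs = xs @ t # ys" "us = xs @ u # ys"
      "u \<in> tree_insertions {1, 2} m t"
      by (auto simp: forest_insertion_iff)
    have "root_label t \<noteq> 1"
    proof
      assume "root_label t = 1"
      moreover have "star_tree t" using star(2) cs by simp
      \<comment> \<open>A childless node in \<open>A\<close> offers no position at all.\<close>
      ultimately have "t = Node 1 []" by (cases t) (simp add: star_children_def)
      then show False using cs(3) by (auto simp: insert_positions_def)
    qed
    moreover from this have "root_label u \<noteq> 1"
      using root_label_insertion[OF cs(3)] Node.prems(3) by auto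
    ultimately have "star_children v (map root_label us)"
      using star(1) by (cases xs) (auto simp: cs star_children_def)
    moreover have "star_tree u"
      using Node.IH[of t u] cs star(2) Node.prems(3) by simp
    ultimately show ?thesis using 3 cs star(2) by auto
  qed
qed

text \<open>Position 0 at node 1 or 2 breaks the shape: a new leaf gives 1 a child or displaces 1 as
  old child of 2, and a new parent puts 1 under \<open>m\<close> or makes 2 childless.\<close>

lemma star_tree_insertionD:
  "star_tree t' \<Longrightarrow> t' \<in> tree_insertions {} m t \<Longrightarrow> 3 \<le> m \<Longrightarrow>
     star_tree t \<and> t' \<in> tree_insertions {1, 2} m t"
proof (induction t arbitrary: t')
  case (Node v cs)
  consider k where "k \<le> length cs" "t' = insert_leaf m v cs k"
    | k where "k \<le> length cs" "t' = insert_parent m v cs k"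
    | us where "us \<in> forest_insertions {} m cs" "t' = Node v us"
    using Node.prems(2) by (auto simp: insert_positions_def)
  then show ?case
  proof cases
    case (1 k)
    have c: "star_children v (map root_label (take k cs @ Node m [] # drop k cs))"
      and s: "\<forall>c\<in>set (take k cs) \<union> set (drop k cs). star_tree c"
      using Node.prems(1) 1 by (auto simp: insert_leaf_def)
    obtain as bs where ab: "take k cs = as" "drop k cs = bs" "cs = as @ bs" "k = 0 \<longleftrightarrow> as = []"
      using 1(1) by (metis append_take_drop_id le_zero_eq list.size(3) take_eq_Nil)
    have "star_children v (map root_label cs) \<and> (v \<in> {1, 2} \<longrightarrow> k \<noteq> 0)"
      using c Node.prems(3) unfolding ab(1,2,4)
      by (cases as) (auto simp: star_children_def ab(3))
    moreover have "\<forall>c\<in>set cs. star_tree c"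
      using s unfolding ab(1,2) by (simp add: ab(3))
    ultimately show ?thesis
      using 1 by (auto simp: insert_positions_def)
  next
    case (2 k)
    have c: "star_children v (map root_label (take k cs))"
      "star_children m (v # map root_label (drop k cs))"
      and s: "\<forall>c\<in>set (take k cs) \<union> set (drop k cs). star_tree c"
      using Node.prems(1) 2 by (auto simp: insert_parent_def)
    obtain as bs where ab: "take k cs = as" "drop k cs = bs" "cs = as @ bs" "k = 0 \<longleftrightarrow> as = []"
      using 2(1) by (metis append_take_drop_id le_zero_eq list.size(3) take_eq_Nil)
    have "star_children v (map root_label cs) \<and> (v \<in> {1, 2} \<longrightarrow> k \<noteq> 0)"
      using c Node.prems(3) unfolding ab(1,2,4)
      by (cases as) (auto simp: star_children_def ab(3))
    moreover have "\<forall>c\<in>set cs. star_tree c"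
      using s unfolding ab(1,2) by (simp add: ab(3))
    ultimately show ?thesis
      using 2 by (auto simp: insert_positions_def)
  next
    case (3 us)
    then obtain xs t u ys where cs: "cs = xs @ t # ys" "us = xs @ u # ys"
      "u \<in> tree_insertions {} m t"
      by (auto simp: forest_insertion_iff)
    have us: "star_children v (map root_label us)" "\<forall>c\<in>set us. star_tree c"
      using Node.prems(1) 3 by auto
    have t: "star_tree t \<and> u \<in> tree_insertions {1, 2} m t"
      using Node.IH[of t u] us(2) cs Node.prems(3) by simp
    have "star_tree u" using us(2) cs by simp
    \<comment> \<open>Since \<open>m\<close> is not 2, the star condition forbids 1 as a child of a
      new root \<open>m\<close>.\<close>
    have new: "1 \<notin> root_label ` set (branches u)" if "root_label u = m"
      using \<open>star_tree u\<close> that Node.prems(3) by (cases u) (simp add: star_children_def)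
    have root: "root_label u = 1 \<longleftrightarrow> root_label t = 1"
      using root_label_insertion[OF cs(3)]
    proof
      assume *: "root_label u = m \<and> root_label t \<in> root_label ` set (branches u)"
      then have "root_label t \<noteq> 1" using new by metis
      then show ?thesis using * Node.prems(3) by simp
    qed simp
    have "star_children v (map root_label cs)"
      using us(1) root root[unfolded eq_commute[of _ 1]]
      unfolding cs(1,2) star_children_def
      by (cases xs) simp_all
    moreover have "us \<in> forest_insertions {1, 2} m cs"
      using t cs by (auto simp: forest_insertion_iff)
    ultimately show ?thesis using 3 cs us(2) t by auto
  qed
qed

lemma star_tree_iff:
  "star_tree T \<longleftrightarrow> (\<forall>v cs. Node v cs \<in> subtrees T \<longrightarrow> star_children v (map root_label cs))"
  by (induction T) auto

text \<open>Label 1 has only one parent, so the condition that it is the old child of 2 excludes it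
  from the children of every other node.\<close>

lemma star_trees_iff:
  "T \<in> star_trees n \<longleftrightarrow> T \<in> labeled_trees (n + 2) \<and> star_tree T"
proof (cases "T \<in> labeled_trees (n + 2)")
  case True
  then have d: "distinct (labels T)" and N: "nodes T = {1..n + 2}"
    by (auto simp: labeled_trees_def)
  have sub: "\<exists>cs. Node v cs \<in> subtrees T" if "v \<in> {1, 2}" for v
  proof -
    have "v \<in> nodes T" using that N by auto
    then obtain t where "t \<in> subtrees T" "root_label t = v"
      using subtree_ex[of v T] by (auto simp: nodes_def)
    then show ?thesis by (cases t) auto
  qed
  obtain cs1 cs2 where cs: "Node 1 cs1 \<in> subtrees T" "Node 2 cs2 \<in> subtrees T"
    using sub by blast
  have ch: "children T 1 = map root_label cs1" "children T 2 = map root_label cs2"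
    using cs children_eq[OF d] by auto
  have star: "T \<in> star_trees n \<longleftrightarrow> cs1 = [] \<and> cs2 \<noteq> [] \<and> hd (map root_label cs2) = 1"
    using True N ch by (auto simp: star_trees_def leaves_def interior_nodes_def old_child_def)
  show ?thesis
  proof
    assume "T \<in> star_trees n"
    then have *: "cs1 = []" "cs2 \<noteq> []" "hd (map root_label cs2) = 1" using star by auto
    have e2: "(2, 1) \<in> edges T"
      unfolding edge_iff[OF d] using cs(2) *(2,3) by (cases cs2) force+
    have "star_children v (map root_label cs)" if v: "Node v cs \<in> subtrees T" for v cs
    proof -
      have c: "map root_label cs = children T v" using children_eq[OF d v] by simp
      have "v = 2" if "1 \<in> set (map root_label cs)"
        using that v e2 parent_unique[OF d _ e2, of v] unfolding edge_iff[OF d] by auto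
      moreover have "distinct (map root_label cs)"
        using distinct_subtree[OF v d] by (intro distinct_root_labels) simp
      ultimately show ?thesis
        using * ch unfolding c star_children_def
        by (metis distinct.simps(2) list.collapse list.map_disc_iff)
    qed
    then show "T \<in> labeled_trees (n + 2) \<and> star_tree T"
      using True by (simp add: star_tree_iff)
  next
    assume "T \<in> labeled_trees (n + 2) \<and> star_tree T"
    then show "T \<in> star_trees n"
      using cs unfolding star by (auto simp: star_tree_iff star_children_def)
  qed
qed (simp add: star_trees_def)

lemma star_trees_0: "star_trees 0 = {Node 2 [Node 1 []]}"
proof -
  have "T = Node 2 [Node 1 []]" if T: "T \<in> labeled_trees 2" "star_tree T" for T
  proof -
    obtain v cs where v: "T = Node v cs" by (cases T)
    have "{1..2::nat} = {1, 2}" by auto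
    then have d: "distinct (labels T)" and N: "nodes T = {1, 2}"
      using T(1) by (simp_all only: labeled_trees_def mem_Collect_eq)
    have "v \<in> {1, 2}" using N root_in_nodes[of T] v by simp
    moreover have "v \<noteq> 1"
    proof
      assume "v = 1"
      then have "nodes T = {1}" using T(2) by (simp add: v star_children_def nodes_Node)
      then show False using N by auto
    qed
    ultimately have "v = 2" by simp
    then have "cs \<noteq> []" using T(2) by (simp add: v star_children_def)
    then obtain w ds es where cs: "cs = Node w ds # es" by (metis list.exhaust ltree.exhaust)
    have "w = 1" using T(2) by (simp add: v cs \<open>v = 2\<close> star_children_def)
    moreover from this have "ds = []" using T(2) by (simp add: v cs star_children_def)
    moreover have "es = []"
    proof (rule ccontr)
      assume "es \<noteq> []"
      then obtain e fs where "es = e # fs" by (cases es) auto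
      then have "root_label e \<in> {1, 2}" "root_label e \<noteq> 1" "root_label e \<noteq> 2"
        using d N root_label_in_labels[of e] root_in_nodes[of e]
        by (auto simp: v cs \<open>v = 2\<close> \<open>w = 1\<close> nodes_Node)
      then show False by simp
    qed
    ultimately show ?thesis by (simp add: v cs \<open>v = 2\<close>)
  qed
  moreover have "Node 2 [Node 1 []] \<in> labeled_trees 2" "star_tree (Node 2 [Node 1 []])"
    by (auto simp: labeled_trees_def nodes_def star_children_def)
  ultimately have "T \<in> labeled_trees 2 \<and> star_tree T \<longleftrightarrow> T = Node 2 [Node 1 []]" for T
    by blast
  then show ?thesis
    unfolding set_eq_iff star_trees_iff add_0 by blast
qed

text \<open>Insertions with \<open>A = {}\<close> exhaust all labeled trees, and the star shape
  selects from them exactly the insertions with \<open>A = {1, 2}\<close> into star trees.\<close>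

lemma star_trees_Suc:
  "star_trees (Suc n) = (\<Union>T\<in>star_trees n. tree_insertions {1, 2} (Suc (n + 2)) T)"
proof -
  have "T' \<in> star_trees (Suc n) \<longleftrightarrow> (\<exists>T\<in>star_trees n. T' \<in> tree_insertions {1, 2} (Suc (n + 2)) T)"
    for T'
  proof
    assume "T' \<in> star_trees (Suc n)"
    then have T': "T' \<in> labeled_trees (Suc (n + 2))" "star_tree T'"
      by (simp_all add: star_trees_iff)
    then obtain T where T: "T \<in> labeled_trees (n + 2)" "T' \<in> tree_insertions {} (Suc (n + 2)) T"
      using labeled_trees_Suc[of "n + 2"] by auto
    then have "star_tree T \<and> T' \<in> tree_insertions {1, 2} (Suc (n + 2)) T"
      by (intro star_tree_insertionD[OF T'(2)]) simp_all
    then show "\<exists>T\<in>star_trees n. T' \<in> tree_insertions {1, 2} (Suc (n + 2)) T"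
      using T(1) star_trees_iff by blast
  next
    assume "\<exists>T\<in>star_trees n. T' \<in> tree_insertions {1, 2} (Suc (n + 2)) T"
    then obtain T where T: "T \<in> labeled_trees (n + 2)" "star_tree T"
      "T' \<in> tree_insertions {1, 2} (Suc (n + 2)) T"
      by (auto simp: star_trees_iff)
    then show "T' \<in> star_trees (Suc n)"
      using insertion_labeled_trees[OF T(3)] star_tree_insertion[OF T(2,3)]
      by (simp add: star_trees_iff)
  qed
  then show ?thesis by blast
qed

section \<open>The two generating polynomials as iterated derivatives\<close>

lemma branches_ne: "T \<in> labeled_trees (Suc n) \<Longrightarrow> n \<ge> 1 \<Longrightarrow> branches T \<noteq> []"
proof
  assume T: "T \<in> labeled_trees (Suc n)" "n \<ge> 1" "branches T = []"
  then have "card (nodes T) = 1" by (cases T) (simp add: nodes_def)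
  moreover have "card (nodes T) = Suc n" using T(1) by (simp add: labeled_trees_def)
  ultimately show False using T(2) by simp
qed

lemma F_eq_weight:
  assumes "n \<ge> 1"
  shows "F n = (\<Sum>T\<in>labeled_trees (Suc n). tree_weight {} 1 T)"
proof -
  have "distinct (labels T)" "branches T \<noteq> []" "nodes T = {1..Suc n}"
    if "T \<in> labeled_trees (Suc n)" for T
    using that branches_ne[OF that assms] by (auto simp: labeled_trees_def)
  then show ?thesis
    unfolding F_def by (intro sum.cong) (simp_all add: tree_weight_eq)
qed

text \<open>Node 1 is a leaf and node 2 is interior, so taking \<open>{1, 2}\<close> out of either
  set removes just the node that the definition leaves out.\<close>

lemma F_star_eq_weight: "F_star n = (\<Sum>T\<in>star_trees n. tree_weight {1, 2} 1 T)"
proof -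
  have "distinct (labels T)" "branches T \<noteq> []" "nodes T = {1..n + 2}"
    "leaves T - {1, 2} = leaves T - {1}" "interior_nodes T - {1, 2} = interior_nodes T - {2}"
    if "T \<in> star_trees n" for T
  proof -
    have T: "T \<in> labeled_trees (Suc (n + 1))" using that by (simp add: star_trees_def)
    then show "distinct (labels T)" "branches T \<noteq> []" "nodes T = {1..n + 2}"
      using branches_ne[OF T] by (auto simp: labeled_trees_def)
    show "leaves T - {1, 2} = leaves T - {1}" "interior_nodes T - {1, 2} = interior_nodes T - {2}"
      using that by (auto simp: star_trees_def leaves_def interior_nodes_def)
  qed
  then show ?thesis
    unfolding F_star_def by (intro sum.cong) (simp_all add: tree_weight_eq)
qed

lemma labeled_trees_1: "labeled_trees 1 = {Node 1 []}"
proof -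
  have "T = Node 1 []" if T: "T \<in> labeled_trees 1" for T
  proof -
    obtain v cs where v: "T = Node v cs" by (cases T)
    have "mset (labels T) = {#1#}" using T by (simp add: labeled_trees_iff)
    then have "v = 1" "concat (map labels cs) = []" by (simp_all add: v)
    moreover from this have "cs = []"
      using root_label_in_labels[of "hd cs"] by (cases cs) auto
    ultimately show ?thesis by (simp add: v)
  qed
  moreover have "Node 1 [] \<in> labeled_trees 1" by (simp add: labeled_trees_def nodes_def)
  ultimately show ?thesis by blast
qed

theorem theorem11:
  fixes D :: "nat \<Rightarrow> 'a::comm_ring_1 laurent \<Rightarrow> 'a laurent" and n :: nat
  assumes "\<And>k. k \<ge> 1 \<Longrightarrow> formal_derivative (grammar k) (D k)"
    and "n \<ge> 1"
  shows "F n = fold D [1..<n + 1] (yvar 1) \<and> F_star n = fold D [2..<n + 2] tvar"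
proof
  have gd: "grammar_derivative k (D k)" if "k \<ge> 1" for k
    using assms(1)[OF that] by unfold_locales
  have sum: "D m (\<Sum>T\<in>X. tree_weight A 1 T)
      = (\<Sum>T\<in>(\<Union>T\<in>X. tree_insertions A (Suc m) T). tree_weight A 1 T)"
    if "X \<subseteq> labeled_trees m" "Suc m \<notin> A" "m \<ge> 1" for X A m
    using grammar_derivative.D_sum_tree_weight[OF gd[OF that(3)] that] .
  have all: "D m (\<Sum>T\<in>labeled_trees m. tree_weight {} 1 T)
      = (\<Sum>T\<in>labeled_trees (Suc m). tree_weight {} 1 T)" if "m \<ge> 1" for m
    using sum[of "labeled_trees m" m "{}"] labeled_trees_Suc[OF that] that by simp
  have "(\<Sum>T\<in>labeled_trees (Suc n). tree_weight {} 1 T) = fold D [1..<n + 1] (yvar 1)"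
    using assms(2)
  proof (induction n rule: dec_induct)
    case base
    interpret grammar_derivative 1 "D 1" by (rule gd) simp
    \<comment> \<open>The recursion is anchored at the tree with one node, of weight
      \<open>xvar 1\<close>; as \<open>xvar 1\<close> and \<open>yvar 1\<close> have the same rule,
      \<open>D 1\<close> does not distinguish them.\<close>
    have "(\<Sum>T\<in>labeled_trees 1. tree_weight {} 1 T) = (xvar 1 :: 'a laurent)"
      unfolding labeled_trees_1 by (simp add: node_weight_def)
    then have "(\<Sum>T\<in>labeled_trees (Suc 1). tree_weight {} 1 T) = D 1 (xvar 1)"
      using all[of 1] by simp
    also have "\<dots> = D 1 (yvar 1)"
      using D_var(1)[of 1] D_var(2)[of 1] by simp
    finally show ?case by simp
  next
    case (step k)
    then show ?case using all[of "Suc k"] by simp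
  qed
  then show "F n = fold D [1..<n + 1] (yvar 1)"
    by (simp only: F_eq_weight[OF assms(2)])
  have "(\<Sum>T\<in>star_trees n. tree_weight {1, 2} 1 T) = fold D [2..<n + 2] tvar"
  proof (induction n)
    case 0
    \<comment> \<open>The only edge, from 2 to 1, is improper, so the weight is
      \<open>tvar\<close>.\<close>
    show ?case
      by (simp add: star_trees_0 node_weight_def edge_weight_def min_label_def nodes_def)
  next
    case (Suc k)
    \<comment> \<open>Trees in \<open>star_trees k\<close> have \<open>k + 2\<close> nodes, so
      \<open>D (k + 2)\<close> inserts the label \<open>k + 3\<close>, which is outside
      \<open>{1, 2}\<close>.\<close>
    have "star_trees k \<subseteq> labeled_trees (k + 2)" by (auto simp: star_trees_def)
    then have "(\<Sum>T\<in>star_trees (Suc k). tree_weight {1, 2} 1 T)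
        = D (k + 2) (\<Sum>T\<in>star_trees k. tree_weight {1, 2} 1 T)"
      by (subst sum) (simp_all only: star_trees_Suc, simp_all)
    then show ?case using Suc by simp
  qed
  then show "F_star n = fold D [2..<n + 2] tvar"
    by (simp only: F_star_eq_weight)
qed

end
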